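(* Let $D$ be a planar oriented graph on $n$ vertices with digirth $g$. Then $D$ contains an acyclic set of size at least $n - 3n/g$. Moreover, if $g = 4$, then $D$ contains an acyclic set of size at least $5n/12$, and if $g = 5$, then $D$ contains an acyclic set of size at least $7n/15$.
   Context: An oriented graph is a directed graph with no loops in which any pair of vertices is joined by at most one arc; in particular it has no directed 2-cycles. It is planar if its underlying undirected graph is planar. The digirth of a digraph is the length of its shortest directed cycle. An acyclic set in a digraph is a set of vertices whose induced subdigraph contains no directed cycle. *)

theory Defs
  imports "HOL-Analysis.Analysis" "Graph_Theory.Graph_Theory"
begin

locale oriented_graph = fin_digraph + loopfree_digraph +
  assumes at_most_one_arc:
    "\<lbrakk>e1 \<in> arcs G; e2 \<in> arcs G; {tail G e1, head G e1} = {tail G e2, head G e2}\<rbrakk> \<Longrightarrow> e1 = e2"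

sublocale oriented_graph \<subseteq> digraph
  by unfold_locales (auto simp: arc_to_ends_def intro: at_most_one_arc)

definition underlying_edges :: "('a, 'b) pre_digraph \<Rightarrow> 'a set set" where
  "underlying_edges G = (\<lambda>e. {tail G e, head G e}) ` arcs G"

text \<open>
  A drawing of a simple graph \<open>(V, E)\<close> in the plane (identified with the complex numbers):
  distinct vertices are distinct points, each edge is a Jordan arc joining its two ends, and the
  interior of an edge contains neither a vertex nor a point of another edge.
\<close>
definition plane_drawing ::
  "'a set \<Rightarrow> 'a set set \<Rightarrow> ('a \<Rightarrow> complex) \<Rightarrow> ('a set \<Rightarrow> real \<Rightarrow> complex) \<Rightarrow> bool" where
  "plane_drawing V E pos \<gamma> \<longleftrightarrow>
     inj_on pos V \<and>
     (\<forall>e\<in>E. Path_Connected.arc (\<gamma> e) \<and> {pathstart (\<gamma> e), pathfinish (\<gamma> e)} = pos ` e) \<and>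
     (\<forall>e\<in>E. \<gamma> e ` {0<..<1} \<inter> pos ` V = {}) \<and>
     (\<forall>e\<in>E. \<forall>f\<in>E. e \<noteq> f \<longrightarrow> \<gamma> e ` {0<..<1} \<inter> path_image (\<gamma> f) = {})"

definition planar_digraph :: "('a, 'b) pre_digraph \<Rightarrow> bool" where
  "planar_digraph G \<longleftrightarrow> (\<exists>pos \<gamma>. plane_drawing (verts G) (underlying_edges G) pos \<gamma>)"

text \<open>The digirth is \<open>\<infinity>\<close> if there is no directed cycle.\<close>
definition digirth :: "('a, 'b) pre_digraph \<Rightarrow> enat" where
  "digirth G = (INF p \<in> {p. pre_digraph.cycle G p}. enat (length p))"

definition acyclic_set :: "('a, 'b) pre_digraph \<Rightarrow> 'a set \<Rightarrow> bool" where
  "acyclic_set G S \<longleftrightarrow> S \<subseteq> verts G \<and> \<not> (\<exists>p. pre_digraph.cycle (G \<restriction> S) p)"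

end

theory Submission
  imports Defs "HOL-Complex_Analysis.Winding_Numbers"
begin

text \<open>
  A set \<open>J\<close> of at most \<open>m / g\<close> arcs meeting all directed cycles exists by the Lucchesi--Younger theorem
  applied to the planar dual, where directed cycles become directed cuts, and \<open>m \<le> 3 n\<close> by Euler's
  formula. Deleting the tails of \<open>J\<close> gives the first bound. For the other two, a graph with \<open>n\<close>
  vertices and \<open>k\<close> edges has an independent set of size at least \<open>(2 n - k) / 3\<close>, and a set that is
  independent in the graph with edge set \<open>J\<close> is acyclic.

  The dual is read off the drawing by winding numbers. Every integral circulation \<open>f\<close> has a winding
  number around each point of the complement of the drawing, and each arc \<open>a\<close> has two points next to it
  at which the winding numbers differ by \<open>f a\<close> for all \<open>f\<close> (Jordan curve theorem). So circulations
  are coboundaries of functions on the faces. The converse is an induction on the number of arcs, in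
  which Janiszewski's theorem shows that a new arc splits at most one face, and that one in two.
\<close>

text \<open>Faces get no boundary walks: a bridge has the same face on both sides, and a face of a
  disconnected drawing has several boundary components. What replaces them is the duality between
  circulations and coboundaries of face functions. It turns cycles into cuts and back, and it also
  supplies the count behind \<open>m \<le> 3 n\<close>: the coboundary of the indicator of a face is
  a circulation, and a nonzero circulation of an oriented graph has at least three arcs in its
  support.

  The constants: an independent set keeps \<open>(2 n - 3 n / g) / 3\<close> vertices, which is
  \<open>5 n / 12\<close> for \<open>g = 4\<close> and \<open>7 n / 15\<close> for
  \<open>g = 5\<close>. For positive \<open>n\<close> this exceeds \<open>n - 3 n / g\<close>
  exactly when \<open>g < 6\<close>.

  The Lucchesi-Younger theorem is proved with general integer capacities, although only 0 and 1
  occur in its statement: the core is that a packing for doubled capacities splits into two packings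
  for the original ones.\<close>

hide_const (open) Digraph_Component.connected

section \<open>Packing and covering directed cuts\<close>

lemma sum_update2:
  fixes g :: "'a \<Rightarrow> nat"
  assumes "finite I" "i \<in> I" "j \<in> I" "i \<noteq> j"
  shows "(\<Sum>k\<in>I. g ((X(i := P, j := Q)) k)) + g (X i) + g (X j)
       = (\<Sum>k\<in>I. g (X k)) + g P + g Q"
proof -
  have I: "I = insert i (insert j (I - {i,j}))" using assms by auto
  have s: "(\<Sum>k\<in>I. h k) = h i + h j + (\<Sum>k\<in>I - {i,j}. h k)" for h :: "_ \<Rightarrow> nat"
    using assms by (subst I) (simp add: sum.insert_if)
  have "(\<Sum>k\<in>I - {i,j}. g ((X(i := P, j := Q)) k)) = (\<Sum>k\<in>I - {i,j}. g (X k))"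
    by (rule sum.cong) auto
  then show ?thesis
    unfolding s[of "\<lambda>k. g ((X(i := P, j := Q)) k)"] s[of "\<lambda>k. g (X k)"] using assms(4) by simp
qed

text \<open>Convexity: moving two summands apart with their sum fixed increases the sum of squares.
  This is the quantity that \<open>uncross\<close> maximises.\<close>

lemma square_sum_less:
  fixes p q s t :: nat
  assumes "s + t = p + q" "s < p" "s < q"
  shows "p\<^sup>2 + q\<^sup>2 < s\<^sup>2 + t\<^sup>2"
proof -
  obtain x where x: "p = s + x" "x > 0" using assms(2) less_imp_add_positive by blast
  obtain y where y: "q = s + y" "y > 0" using assms(3) less_imp_add_positive by blast
  have t: "t = s + x + y" using assms x y by simp
  show ?thesis using x y unfolding x(1) y(1) t by (simp add: power2_eq_square algebra_simps)
qed

text \<open>For \<open>c \<le> 2 * w\<close> the bound is at most \<open>w\<close>, also when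
  \<open>c\<close> is odd; this is what halving a packing needs.\<close>

lemma card_parity_interval:
  fixes q c :: nat
  shows "card {n\<in>{q<..q + c}. even n} \<le> (c + 1) div 2 \<and> card {n\<in>{q<..q + c}. odd n} \<le> (c + 1) div 2"
proof -
  have *: "card {n\<in>{q<..q + c}. even n} = (q + c) div 2 - q div 2
      \<and> card {n\<in>{q<..q + c}. odd n} = (q + c + 1) div 2 - (q + 1) div 2"
  proof (induction c)
    case (Suc c)
    have e: "{n\<in>{q<..q + Suc c}. even n} = (if even (q + Suc c) then insert (q + Suc c) {n\<in>{q<..q + c}. even n}
       else {n\<in>{q<..q + c}. even n})" by (auto simp: le_Suc_eq)
    have o: "{n\<in>{q<..q + Suc c}. odd n} = (if odd (q + Suc c) then insert (q + Suc c) {n\<in>{q<..q + c}. odd n}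
       else {n\<in>{q<..q + c}. odd n})" by (auto simp: le_Suc_eq)
    show ?case unfolding e o using Suc
      by (auto simp: card_insert_if; presburger)
  qed auto
  have "(q + c) div 2 - q div 2 \<le> (c + 1) div 2" "(q + c + 1) div 2 - (q + 1) div 2 \<le> (c + 1) div 2"
    by linarith+
  with * show ?thesis by simp
qed

section \<open>Directed cuts, packings and cross-free families\<close>

locale weakly_connected_cuts =
  fixes F :: "'f set" and A :: "'b set" and l r :: "'b \<Rightarrow> 'f"
  assumes finite_F: "finite F" and finite_A: "finite A"
    and ends_in_F: "\<And>a. a \<in> A \<Longrightarrow> l a \<in> F \<and> r a \<in> F"
    and crossing_arc: "\<And>X. X \<subseteq> F \<Longrightarrow> X \<noteq> {} \<Longrightarrow> X \<noteq> F \<Longrightarrow> \<exists>a\<in>A. (l a \<in> X) \<noteq> (r a \<in> X)"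
begin

definition leaves :: "'b \<Rightarrow> 'f set \<Rightarrow> bool" where
  "leaves a X \<longleftrightarrow> l a \<in> X \<and> r a \<notin> X"

definition dicut :: "'f set \<Rightarrow> bool" where
  "dicut X \<longleftrightarrow> X \<subseteq> F \<and> X \<noteq> {} \<and> X \<noteq> F \<and> (\<forall>a\<in>A. r a \<in> X \<longrightarrow> l a \<in> X)"

text \<open>An indexed family and not a set of cuts, since with capacities above 1 the same cut may
  occur several times.\<close>

definition packing :: "('b \<Rightarrow> nat) \<Rightarrow> nat set \<Rightarrow> (nat \<Rightarrow> 'f set) \<Rightarrow> bool" where
  "packing w I X \<longleftrightarrow> (\<forall>i\<in>I. dicut (X i)) \<and> (\<forall>a\<in>A. card {i\<in>I. leaves a (X i)} \<le> w a)"

definition crossfree :: "nat set \<Rightarrow> (nat \<Rightarrow> 'f set) \<Rightarrow> bool" where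
  "crossfree I X \<longleftrightarrow>
     (\<forall>i\<in>I. \<forall>j\<in>I. X i \<subseteq> X j \<or> X j \<subseteq> X i \<or> X i \<inter> X j = {} \<or> X i \<union> X j = F)"

definition packable :: "('b \<Rightarrow> nat) \<Rightarrow> nat \<Rightarrow> bool" where
  "packable w N \<longleftrightarrow> (\<exists>X. packing w {..<N} X)"

lemma dicut_leaving_arc: "dicut X \<Longrightarrow> \<exists>a\<in>A. leaves a X"
  using crossing_arc[of X] unfolding dicut_def leaves_def by blast

lemma dicut_Int_Un:
  assumes "dicut X" "dicut Y" "X \<inter> Y \<noteq> {}" "X \<union> Y \<noteq> F"
  shows "dicut (X \<inter> Y)" "dicut (X \<union> Y)"
  using assms unfolding dicut_def by blast+

text \<open>No arc enters a directed cut, so \<open>leaves a X\<close> is the indicator of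
  \<open>l a \<in> X\<close> minus that of \<open>r a \<in> X\<close>, and such indicators are
  modular under intersection and union.\<close>

lemma leaves_modular:
  assumes "dicut X" "dicut Y" "a \<in> A"
  shows "of_bool (leaves a (X \<inter> Y)) + of_bool (leaves a (X \<union> Y))
       = (of_bool (leaves a X) + of_bool (leaves a Y) :: nat)"
proof -
  have "r a \<in> X \<longrightarrow> l a \<in> X" "r a \<in> Y \<longrightarrow> l a \<in> Y" using assms by (auto simp: dicut_def)
  then show ?thesis by (auto simp: leaves_def)
qed

lemma card_leaves_eq_sum:
  "finite I \<Longrightarrow> card {i\<in>I. leaves a (X i)} = (\<Sum>i\<in>I. of_bool (leaves a (X i)))"
  by (simp add: Int_def)

text \<open>Replacing crossing members by their intersection and union keeps the covering
  multiplicities and increases the sum of the squared cardinalities.\<close>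

lemma uncross:
  assumes I: "finite I" and X: "packing w I X"
  shows "\<exists>Y. packing w I Y \<and> crossfree I Y"
proof -
  define m where "m Y = (\<Sum>i\<in>I. (card (Y i))\<^sup>2)" for Y :: "nat \<Rightarrow> 'f set"
  have bound: "m Y < Suc (card I * (card F)\<^sup>2)" if "packing w I Y" for Y
  proof -
    have "m Y \<le> (\<Sum>i\<in>I. (card F)\<^sup>2)" unfolding m_def
      using that finite_F by (intro sum_mono power_mono card_mono) (auto simp: packing_def dicut_def)
    then show ?thesis by simp
  qed
  obtain Y where Y: "packing w I Y" and max: "\<And>Z. packing w I Z \<Longrightarrow> m Z \<le> m Y"
    using Lattices_Big.ex_has_greatest_nat[where P = "packing w I" and f = m, OF X] bound by blast
  have "crossfree I Y"
  proof (rule ccontr)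
    assume "\<not> crossfree I Y"
    then obtain i j where ij: "i \<in> I" "j \<in> I" "\<not> Y i \<subseteq> Y j" "\<not> Y j \<subseteq> Y i"
      "Y i \<inter> Y j \<noteq> {}" "Y i \<union> Y j \<noteq> F" unfolding crossfree_def by blast
    then have ne: "i \<noteq> j" by auto
    define Z where "Z = Y(i := Y i \<inter> Y j, j := Y i \<union> Y j)"
    have dc: "dicut (Y i)" "dicut (Y j)" using Y ij by (auto simp: packing_def)
    have fin: "finite (Y i)" "finite (Y j)"
      using dc finite_F by (auto simp: dicut_def intro: finite_subset)
    have "packing w I Z" unfolding packing_def
    proof (intro conjI ballI)
      fix k assume "k \<in> I"
      then show "dicut (Z k)" using Y dicut_Int_Un[OF dc ij(5,6)] by (auto simp: Z_def packing_def)
    next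
      fix a assume a: "a \<in> A"
      have "(\<Sum>k\<in>I. of_bool (leaves a (Z k))) = (\<Sum>k\<in>I. of_bool (leaves a (Y k)) :: nat)"
        using sum_update2[OF I ij(1,2) ne, of "\<lambda>S. of_bool (leaves a S)" Y "Y i \<inter> Y j" "Y i \<union> Y j"]
          leaves_modular[OF dc a] unfolding Z_def by linarith
      then have "card {k\<in>I. leaves a (Z k)} = card {k\<in>I. leaves a (Y k)}"
        by (simp only: card_leaves_eq_sum[OF I])
      then show "card {k\<in>I. leaves a (Z k)} \<le> w a"
        using Y a by (simp add: packing_def)
    qed
    moreover have "m Y < m Z"
    proof -
      have "card (Y i \<inter> Y j) + card (Y i \<union> Y j) = card (Y i) + card (Y j)"
        using card_Un_Int[OF fin] by simp
      moreover have "card (Y i \<inter> Y j) < card (Y i)" "card (Y i \<inter> Y j) < card (Y j)"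
        using ij fin by (auto intro!: psubset_card_mono)
      ultimately have "(card (Y i))\<^sup>2 + (card (Y j))\<^sup>2
          < (card (Y i \<inter> Y j))\<^sup>2 + (card (Y i \<union> Y j))\<^sup>2" by (rule square_sum_less)
      then show ?thesis
        using sum_update2[OF I ij(1,2) ne, of "\<lambda>S. (card S)\<^sup>2" Y "Y i \<inter> Y j" "Y i \<union> Y j"]
        unfolding m_def Z_def by linarith
    qed
    ultimately show False using max[of Z] by simp
  qed
  with Y show ?thesis by blast
qed

text \<open>The members of a cross-free family are the edges of a tree, and \<open>k\<close> below is the height of
  such an edge; the members left by a given arc form a directed path of the tree. So splitting
  the family by the parity of the height splits the members left by each arc evenly.\<close>

lemma crossfree_split:
  assumes I: "finite I" and X: "packing (\<lambda>a. 2 * w a) I X" and cf: "crossfree I X"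
  shows "\<exists>I1 I2. I1 \<union> I2 = I \<and> I1 \<inter> I2 = {} \<and> packing w I1 X \<and> packing w I2 X"
proof -
  \<comment> \<open>The tie-break by index puts repeated members into a chain, so that they too get
    different heights.\<close>
  define above where "above i j \<longleftrightarrow> X i \<subset> X j \<or> X i = X j \<and> i \<le> j" for i j
  define k where "k i = card {j\<in>I. above i j \<or> X i \<union> X j = F}" for i
  have dc: "dicut (X i)" if "i \<in> I" for i using X that by (simp add: packing_def)
  have half: "card {i\<in>I. even (k i) \<and> leaves a (X i)} \<le> w a \<and>
      card {i\<in>I. odd (k i) \<and> leaves a (X i)} \<le> w a" if a: "a \<in> A" for a
  proof -
    define Ia where "Ia = {i\<in>I. leaves a (X i)}"
    define q where "q = card {j\<in>I. r a \<in> X j}"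
    have finIa: "finite Ia" using I by (simp add: Ia_def)
    have ki: "k i = q + card {j\<in>Ia. above i j}" if i: "i \<in> Ia" for i
    proof -
      \<comment> \<open>A member containing \<open>r a\<close> also contains \<open>l a\<close>, so
        it meets \<open>X i\<close> without lying inside it, and cross-freeness leaves only the two
        alternatives counted by \<open>k i\<close>. A member counted by \<open>k i\<close> that
        misses \<open>r a\<close> cannot complete \<open>X i\<close> to \<open>F\<close>, so it is
        above \<open>i\<close> and is left by \<open>a\<close>. Hence the heights of the members
        left by \<open>a\<close> are the consecutive numbers
        \<open>q + 1, ..., q + card Ia\<close>.\<close>
      have "{j\<in>I. above i j \<or> X i \<union> X j = F} = {j\<in>I. r a \<in> X j} \<union> {j\<in>Ia. above i j}"
      proof (intro set_eqI iffI)
        fix j assume j: "j \<in> {j\<in>I. above i j \<or> X i \<union> X j = F}"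
        show "j \<in> {j\<in>I. r a \<in> X j} \<union> {j\<in>Ia. above i j}"
          using i j ends_in_F[OF a] unfolding Ia_def leaves_def above_def by auto
      next
        fix j assume "j \<in> {j\<in>I. r a \<in> X j} \<union> {j\<in>Ia. above i j}"
        then consider "j \<in> I" "r a \<in> X j" | "j \<in> Ia" "above i j" by blast
        then show "j \<in> {j\<in>I. above i j \<or> X i \<union> X j = F}"
        proof cases
          case 1
          have "l a \<in> X j" using 1 dc[of j] a by (auto simp: dicut_def)
          then have "X i \<subset> X j \<or> X i \<union> X j = F"
            using i 1 cf unfolding crossfree_def Ia_def leaves_def by blast
          then show ?thesis using 1 by (auto simp: above_def)
        qed (auto simp: Ia_def)
      qed
      moreover have "{j\<in>I. r a \<in> X j} \<inter> {j\<in>Ia. above i j} = {}"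
        by (auto simp: Ia_def leaves_def)
      ultimately show ?thesis
        using I finIa by (simp add: k_def q_def card_Un_disjoint)
    qed
    have comp: "above i j \<or> above j i" if "i \<in> Ia" "j \<in> Ia" for i j
    proof -
      have "X i \<inter> X j \<noteq> {}" "X i \<union> X j \<noteq> F"
        using that ends_in_F[OF a] by (auto simp: Ia_def leaves_def)
      then have "X i \<subseteq> X j \<or> X j \<subseteq> X i"
        using that cf unfolding crossfree_def Ia_def by blast
      then show ?thesis unfolding above_def by (metis nat_le_linear psubsetI)
    qed
    have strict: "k j < k i" if "i \<in> Ia" "j \<in> Ia" "i \<noteq> j" "above i j" for i j
    proof -
      have "{h\<in>Ia. above j h} \<subset> {h\<in>Ia. above i h}"
        using that unfolding above_def by (auto intro!: psubsetI)
      then have "card {h\<in>Ia. above j h} < card {h\<in>Ia. above i h}"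
        using finIa by (intro psubset_card_mono) auto
      then show ?thesis using ki that by simp
    qed
    have inj: "inj_on k Ia"
      by (rule inj_onI) (metis comp strict less_irrefl)
    have range: "k ` Ia \<subseteq> {q<..q + card Ia}"
    proof
      fix n assume "n \<in> k ` Ia"
      then obtain i where i: "i \<in> Ia" "n = k i" by blast
      have "i \<in> {j\<in>Ia. above i j}" using i by (simp add: above_def)
      then have "card {j\<in>Ia. above i j} > 0" using finIa by (auto simp: card_gt_0_iff)
      moreover have "card {j\<in>Ia. above i j} \<le> card Ia" using finIa by (intro card_mono) auto
      ultimately show "n \<in> {q<..q + card Ia}" using ki[OF i(1)] i(2) by simp
    qed
    have c: "card Ia \<le> 2 * w a" using X a by (simp add: packing_def Ia_def)
    have "card {i\<in>I. P (k i) \<and> leaves a (X i)} \<le> card {n\<in>{q<..q + card Ia}. P n}" for P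
    proof (rule card_inj_on_le)
      show "inj_on k {i\<in>I. P (k i) \<and> leaves a (X i)}"
        using inj by (rule inj_on_subset) (auto simp: Ia_def)
      show "k ` {i\<in>I. P (k i) \<and> leaves a (X i)} \<subseteq> {n\<in>{q<..q + card Ia}. P n}"
        using range by (fastforce simp: Ia_def)
    qed auto
    from this[of even] this[of odd] show ?thesis
      using card_parity_interval[of q "card Ia"] c by linarith
  qed
  have "packing w {i\<in>I. even (k i)} X" "packing w {i\<in>I. odd (k i)} X"
    using half dc unfolding packing_def by (auto simp: conj_assoc)
  then show ?thesis
    by (intro exI[of _ "{i\<in>I. even (k i)}"] exI[of _ "{i\<in>I. odd (k i)}"]) auto
qed

section \<open>Capacities that admit a given number of directed cuts\<close>

lemma packable_if_packing:
  assumes "finite I" "packing w I X"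
  shows "packable w (card I)"
proof -
  obtain f where f: "bij_betw f {..<card I} I"
    using ex_bij_betw_nat_finite[OF assms(1)] by (auto simp: atLeast0LessThan)
  have "card {i\<in>{..<card I}. leaves a (X (f i))} = card {i\<in>I. leaves a (X i)}" for a
  proof (rule bij_betw_same_card)
    show "bij_betw f {i\<in>{..<card I}. leaves a (X (f i))} {i\<in>I. leaves a (X i)}"
      using f unfolding bij_betw_def inj_on_def by auto
  qed
  then have "packing w {..<card I} (\<lambda>i. X (f i))"
    using assms(2) f unfolding packing_def bij_betw_def by auto
  then show ?thesis unfolding packable_def by blast
qed

lemma packable_antimono: "packable w N \<Longrightarrow> M \<le> N \<Longrightarrow> packable w M"
proof -
  assume "packable w N" and MN: "M \<le> N"
  then obtain X where X: "packing w {..<N} X" by (auto simp: packable_def)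
  have "packing w {..<M} X"
    unfolding packing_def
  proof (intro conjI ballI)
    fix a assume a: "a \<in> A"
    have "card {i\<in>{..<M}. leaves a (X i)} \<le> card {i\<in>{..<N}. leaves a (X i)}"
      using MN by (intro card_mono) auto
    also have "\<dots> \<le> w a" using X a by (auto simp: packing_def)
    finally show "card {i\<in>{..<M}. leaves a (X i)} \<le> w a" .
  qed (use X MN in \<open>auto simp: packing_def\<close>)
  then show ?thesis by (auto simp: packable_def)
qed

lemma packable_mono: "packable w N \<Longrightarrow> (\<And>a. a \<in> A \<Longrightarrow> w a \<le> w' a) \<Longrightarrow> packable w' N"
  unfolding packable_def packing_def by (meson order_trans)

lemma packable_add:
  assumes "packable w N" "packable w' M"
  shows "packable (\<lambda>a. w a + w' a) (N + M)"
proof -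
  obtain X Y where X: "packing w {..<N} X" and Y: "packing w' {..<M} Y"
    using assms by (auto simp: packable_def)
  define Z where "Z i = (if i < N then X i else Y (i - N))" for i
  have "packing (\<lambda>a. w a + w' a) {..<N + M} Z"
    unfolding packing_def
  proof (intro conjI ballI)
    fix i assume "i \<in> {..<N + M}"
    then show "dicut (Z i)" using X Y by (auto simp: Z_def packing_def)
  next
    fix a assume a: "a \<in> A"
    have "{i\<in>{..<N + M}. leaves a (Z i)}
        = {i\<in>{..<N}. leaves a (X i)} \<union> (\<lambda>i. i + N) ` {i\<in>{..<M}. leaves a (Y i)}" (is "_ = ?P \<union> ?Q")
    proof (intro set_eqI iffI)
      fix i assume "i \<in> {i\<in>{..<N + M}. leaves a (Z i)}"
      then show "i \<in> ?P \<union> ?Q"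
        by (cases "i < N") (auto simp: Z_def image_iff intro!: exI[of _ "i - N"])
    qed (auto simp: Z_def)
    moreover have "card (?P \<union> ?Q) \<le> card ?P + card ?Q" by (rule card_Un_le)
    moreover have "card ?Q = card {i\<in>{..<M}. leaves a (Y i)}" by (rule card_image) auto
    ultimately show "card {i\<in>{..<N + M}. leaves a (Z i)} \<le> w a + w' a"
      using X Y a by (fastforce simp: packing_def intro: order_trans add_mono)
  qed
  then show ?thesis by (auto simp: packable_def)
qed

text \<open>The two parts may differ in size; it is enough for the application that one of them
  contains at least half of the cuts.\<close>

lemma packable_halve:
  assumes "packable (\<lambda>a. 2 * w a) N"
  shows "\<exists>N1 N2. N1 + N2 = N \<and> packable w N1 \<and> packable w N2"
proof -
  obtain X where X: "packing (\<lambda>a. 2 * w a) {..<N} X" using assms by (auto simp: packable_def)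
  obtain Y where Y: "packing (\<lambda>a. 2 * w a) {..<N} Y" "crossfree {..<N} Y"
    using uncross[OF _ X] by blast
  obtain I1 I2 where I: "I1 \<union> I2 = {..<N}" "I1 \<inter> I2 = {}" "packing w I1 Y" "packing w I2 Y"
    using crossfree_split[OF _ Y] by blast
  then have "finite I1" "finite I2" by (metis finite_Un finite_lessThan)+
  moreover from this have "card I1 + card I2 = N"
    using I(1,2) card_Un_disjoint[of I1 I2] by simp
  ultimately show ?thesis using I(3,4) packable_if_packing by blast
qed

text \<open>Weak connectivity gives every directed cut a leaving arc, so packings are bounded and a
  largest one exists.\<close>

lemma packable_le:
  assumes "packable w N"
  shows "N \<le> (\<Sum>a\<in>A. w a)"
proof -
  obtain X where X: "packing w {..<N} X" using assms by (auto simp: packable_def)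
  have "N = (\<Sum>i<N. 1)" by simp
  also have "\<dots> \<le> (\<Sum>i<N. card {a\<in>A. leaves a (X i)})"
  proof (rule sum_mono)
    fix i assume "i \<in> {..<N}"
    then have "dicut (X i)" using X by (simp add: packing_def)
    then have "{a\<in>A. leaves a (X i)} \<noteq> {}" using dicut_leaving_arc by blast
    then show "1 \<le> card {a\<in>A. leaves a (X i)}"
      using finite_A by (simp add: Suc_le_eq card_gt_0_iff)
  qed
  also have "\<dots> = (\<Sum>a\<in>A. card {i\<in>{..<N}. leaves a (X i)})"
    by (rule sum_multicount_gen) (use finite_A in auto)
  also have "\<dots> \<le> (\<Sum>a\<in>A. w a)" using X by (intro sum_mono) (auto simp: packing_def)
  finally show ?thesis .
qed

text \<open>Capacity 0 outside \<open>B\<close> forbids those arcs without changing the digraph or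
  its cuts, which permits induction on \<open>B\<close>. The packing and \<open>J\<close> have equal
  size and so certify each other; the argument compares the largest packing for \<open>B\<close>
  with those for \<open>B - {a}\<close>.\<close>

theorem Lucchesi_Younger_subset:
  assumes "B \<subseteq> A"
  shows "\<exists>J\<subseteq>B. packable (\<lambda>a. of_bool (a \<in> B)) (card J) \<and>
     (\<forall>Y. dicut Y \<longrightarrow> {a\<in>A. leaves a Y} \<subseteq> B \<longrightarrow> (\<exists>a\<in>J. leaves a Y))"
  using assms
proof (induction "card B" arbitrary: B rule: less_induct)
  case less
  have finB: "finite B" using less.prems finite_A finite_subset by blast
  define ind where "ind C = (\<lambda>a. of_bool (a \<in> C) :: nat)" for C :: "'b set"
  have "packable (ind B) 0" by (simp add: packable_def packing_def)
  moreover have "\<forall>N. packable (ind B) N \<longrightarrow> N \<le> (\<Sum>a\<in>A. ind B a)" using packable_le by blast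
  ultimately have "\<exists>k. packable (ind B) k \<and> (\<forall>N. packable (ind B) N \<longrightarrow> N \<le> k)"
    by (rule Nat.ex_has_greatest_nat)
  then obtain k where k: "packable (ind B) k" and k_max: "\<And>N. packable (ind B) N \<Longrightarrow> N \<le> k" by blast
  show ?case
  proof (cases "\<exists>a\<in>B. \<not> packable (ind (B - {a})) k")
    case True
    then obtain a where a: "a \<in> B" "\<not> packable (ind (B - {a})) k" by blast
    have "card (B - {a}) < card B" using a finB by (intro psubset_card_mono) auto
    then obtain J where J: "J \<subseteq> B - {a}" "packable (ind (B - {a})) (card J)"
      "\<And>Y. dicut Y \<Longrightarrow> {b\<in>A. leaves b Y} \<subseteq> B - {a} \<Longrightarrow> \<exists>b\<in>J. leaves b Y"
      using less.hyps[of "B - {a}"] less.prems unfolding ind_def by blast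
    \<comment> \<open>Forbidding \<open>a\<close> lowers the maximum, so the cover for
      \<open>B - {a}\<close> is small enough to admit \<open>a\<close> as a further element.\<close>
    have "card J < k" using J(2) a(2) packable_antimono not_less by blast
    moreover have "card (insert a J) = Suc (card J)"
      using J(1) finB finite_subset by (subst card_insert_disjoint) (auto dest: finite_subset)
    ultimately have "packable (ind B) (card (insert a J))" using k packable_antimono by simp
    moreover have "\<exists>b\<in>insert a J. leaves b Y" if "dicut Y" "{b\<in>A. leaves b Y} \<subseteq> B" for Y
      using J(3)[of Y] that by blast
    ultimately show ?thesis using J(1) a(1) unfolding ind_def by (intro exI[of _ "insert a J"]) blast
  next
    case False
    then have avoid: "packable (ind (B - {a})) k" if "a \<in> B" for a using that by blast
    \<comment> \<open>Otherwise raise the capacities from \<open>ind B\<close> to twice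
      \<open>ind B\<close> one arc at a time; in the end \<open>k + k\<close> cuts fit, hence also
      \<open>Suc k\<close>. Let \<open>a\<close> be the arc whose raise first makes
      \<open>Suc k\<close> cuts fit. Together with \<open>k\<close> cuts that \<open>a\<close> does
      not leave they use at most twice the capacities from before that raise, so halving
      \<open>2 * k + 1\<close> cuts yields \<open>Suc k\<close> of them already there.\<close>
    have "k = 0"
    proof (rule ccontr)
      assume "k \<noteq> 0"
      define P where "P C \<longleftrightarrow> \<not> packable (\<lambda>a. ind B a + ind C a) (Suc k)" for C
      have "\<not> P B"
        using packable_add[OF k k] \<open>k \<noteq> 0\<close> packable_antimono[of _ "k + k" "Suc k"] by (auto simp: P_def)
      have "P {}" using k_max[of "Suc k"] by (auto simp: P_def ind_def)
      have "\<exists>C a. C \<subseteq> B \<and> a \<in> B \<and> a \<notin> C \<and> P C \<and> \<not> P (insert a C)"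
      proof (rule ccontr)
        assume "\<nexists>C a. C \<subseteq> B \<and> a \<in> B \<and> a \<notin> C \<and> P C \<and> \<not> P (insert a C)"
        then have step: "P (insert a C)" if "a \<in> B" "C \<subseteq> B" "a \<notin> C" "P C" for a C using that by metis
        have "P B"
          by (rule finite_subset_induct'[OF finB subset_refl]) (auto intro: step \<open>P {}\<close>)
        with \<open>\<not> P B\<close> show False ..
      qed
      then obtain C a where C: "C \<subseteq> B" "a \<in> B" "a \<notin> C" "P C" "\<not> P (insert a C)" by blast
      have "packable (\<lambda>b. (ind B b + ind (insert a C) b) + ind (B - {a}) b) (Suc k + k)"
        by (rule packable_add[OF _ avoid[OF C(2)]]) (use C(5) in \<open>simp add: P_def\<close>)
      then have "packable (\<lambda>b. 2 * (ind B b + ind C b)) (Suc k + k)"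
        by (rule packable_mono) (use C in \<open>auto simp: ind_def\<close>)
      then obtain N1 N2 where N: "N1 + N2 = Suc k + k"
        "packable (\<lambda>b. ind B b + ind C b) N1" "packable (\<lambda>b. ind B b + ind C b) N2"
        using packable_halve[of "\<lambda>b. ind B b + ind C b"] by blast
      have "Suc k \<le> N1 \<or> Suc k \<le> N2" using N(1) by linarith
      then show False using N(2,3) packable_antimono C(4) unfolding P_def by blast
    qed
    have "\<not> {a\<in>A. leaves a Y} \<subseteq> B" if "dicut Y" for Y
    proof
      assume Y: "{a\<in>A. leaves a Y} \<subseteq> B"
      have "packing (ind B) {0} (\<lambda>_. Y)"
        unfolding packing_def
      proof (intro conjI ballI)
        fix a assume "a \<in> A"
        have "card {i\<in>{0::nat}. leaves a Y} = of_bool (leaves a Y)" by simp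
        then show "card {i\<in>{0::nat}. leaves a Y} \<le> ind B a" using Y \<open>a \<in> A\<close> by (auto simp: ind_def)
      qed (rule that)
      then have "packable (ind B) (card {0::nat})" by (rule packable_if_packing[rotated]) simp
      then show False using k_max[of 1] \<open>k = 0\<close> by simp
    qed
    then show ?thesis
      using \<open>packable (ind B) 0\<close> unfolding ind_def by (intro exI[of _ "{}"]) auto
  qed
qed

text \<open>With all capacities 1 the packed cuts share no leaving arc, and each of them has at
  least \<open>g\<close>.\<close>

corollary small_dijoin:
  assumes g: "\<And>X. dicut X \<Longrightarrow> g \<le> card {a\<in>A. leaves a X}"
  shows "\<exists>J\<subseteq>A. card J * g \<le> card A \<and> (\<forall>X. dicut X \<longrightarrow> (\<exists>a\<in>J. leaves a X))"
proof -
  obtain J where J: "J \<subseteq> A" "packable (\<lambda>a. of_bool (a \<in> A)) (card J)"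
     "\<And>Y. dicut Y \<Longrightarrow> {a\<in>A. leaves a Y} \<subseteq> A \<Longrightarrow> (\<exists>a\<in>J. leaves a Y)"
    using Lucchesi_Younger_subset[OF subset_refl] by metis
  then obtain X where X: "packing (\<lambda>a. of_bool (a \<in> A)) {..<card J} X" by (auto simp: packable_def)
  have "card J * g = (\<Sum>i<card J. g)" by simp
  also have "\<dots> \<le> (\<Sum>i<card J. card {a\<in>A. leaves a (X i)})"
    using X by (intro sum_mono g) (auto simp: packing_def)
  also have "\<dots> = (\<Sum>a\<in>A. card {i\<in>{..<card J}. leaves a (X i)})"
    by (rule sum_multicount_gen) (use finite_A in auto)
  also have "\<dots> \<le> (\<Sum>a\<in>A. 1)" using X by (intro sum_mono) (auto simp: packing_def)
  finally show ?thesis using J by auto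
qed

end

section \<open>Circulations of a plane digraph\<close>

definition circulation :: "'b set \<Rightarrow> ('b \<Rightarrow> 'v) \<Rightarrow> ('b \<Rightarrow> 'v) \<Rightarrow> ('b \<Rightarrow> int) \<Rightarrow> bool" where
  "circulation A s t f \<longleftrightarrow> (\<forall>v. (\<Sum>a\<in>A. f a * (of_bool (s a = v) - of_bool (t a = v))) = 0)"

lemma circulation_add:
  "circulation A s t f \<Longrightarrow> circulation A s t g \<Longrightarrow> circulation A s t (\<lambda>a. f a + g a)"
  by (simp add: circulation_def distrib_right sum.distrib)

lemma circulation_cmult:
  "circulation A s t f \<Longrightarrow> circulation A s t (\<lambda>a. k * f a)"
  by (simp add: circulation_def mult.assoc flip: sum_distrib_left)

lemma circulation_cong:
  "(\<And>a. a \<in> A \<Longrightarrow> f a = g a) \<Longrightarrow> circulation A s t f = circulation A s t g"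
  by (simp add: circulation_def cong: sum.cong)

text \<open>Summation by parts. The potential will be a logarithm, for the integrality of winding
  numbers, and the indicator of a component, for bridges.\<close>

lemma circulation_potential:
  fixes p :: "'v \<Rightarrow> 'c::comm_ring_1"
  assumes "finite A" "circulation A s t f"
  shows "(\<Sum>a\<in>A. of_int (f a) * (p (s a) - p (t a))) = 0"
proof -
  define U where "U = s ` A \<union> t ` A"
  have U: "finite U" using assms by (simp add: U_def)
  have expand: "p x = (\<Sum>v\<in>U. p v * of_bool (x = v))" if "x \<in> U" for x
    using U that by (simp add: of_bool_def if_distrib cong: if_cong)
  have "(\<Sum>a\<in>A. of_int (f a) * (p (s a) - p (t a)))
      = (\<Sum>a\<in>A. \<Sum>v\<in>U. p v * (of_int (f a) * (of_bool (s a = v) - of_bool (t a = v))))"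
  proof (rule sum.cong[OF refl])
    fix a assume a: "a \<in> A"
    have "p (s a) - p (t a) = (\<Sum>v\<in>U. p v * (of_bool (s a = v) - of_bool (t a = v)))"
      using expand[of "s a"] expand[of "t a"] a
      by (simp add: U_def sum_subtractf algebra_simps)
    then show "of_int (f a) * (p (s a) - p (t a))
        = (\<Sum>v\<in>U. p v * (of_int (f a) * (of_bool (s a = v) - of_bool (t a = v))))"
      by (simp add: sum_distrib_left mult.left_commute)
  qed
  also have "\<dots> = (\<Sum>v\<in>U. p v * of_int (\<Sum>a\<in>A. f a * (of_bool (s a = v) - of_bool (t a = v))))"
    by (subst sum.swap) (simp add: sum_distrib_left)
  also have "\<dots> = 0" using assms(2) unfolding circulation_def by simp
  finally show ?thesis .
qed

lemma path_image_interior_ends: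
  "path_image p = p ` {0<..<1} \<union> {pathstart p, pathfinish p}"
proof -
  have "{0..1::real} = {0<..<1} \<union> {0, 1}" by auto
  then show ?thesis by (simp add: path_image_def pathstart_def pathfinish_def image_Un insert_commute)
qed

lemma path_image_subset_closure_interior:
  assumes "path p" shows "path_image p \<subseteq> closure (p ` {0<..<1})"
proof -
  have "p ` closure {0<..<1} \<subseteq> closure (p ` {0<..<1})"
    using assms by (intro image_closure_subset) (auto simp: path_def closure_subset)
  then show ?thesis by (simp add: path_image_def)
qed

lemma connected_subset_singleton: "S \<subseteq> {x} \<Longrightarrow> connected S"
  using connected_sing[of x] connected_empty by (metis subset_singletonD)

lemma image_Diff_collision:
  assumes "u \<in> S" "u \<noteq> v" "g u = g v"
  shows "g ` S = g ` (S - {v})"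
proof -
  have "g x \<in> g ` (S - {v})" if "x \<in> S" for x
    using assms that by (cases "x = v") (auto intro: rev_image_eqI[of u])
  then show ?thesis by blast
qed

section \<open>Plane drawings and winding numbers of circulations\<close>

locale plane_digraph =
  fixes V :: "complex set" and A :: "'b set" and c :: "'b \<Rightarrow> real \<Rightarrow> complex"
  assumes finite_V: "finite V" and finite_A: "finite A"
    and arc_c: "\<And>a. a \<in> A \<Longrightarrow> Path_Connected.arc (c a)"
    and ends_in_V: "\<And>a. a \<in> A \<Longrightarrow> pathstart (c a) \<in> V \<and> pathfinish (c a) \<in> V"
    and interior_no_vertex: "\<And>a. a \<in> A \<Longrightarrow> c a ` {0<..<1} \<inter> V = {}"
    and interior_no_crossing:
      "\<And>a b. a \<in> A \<Longrightarrow> b \<in> A \<Longrightarrow> a \<noteq> b \<Longrightarrow> c a ` {0<..<1} \<inter> path_image (c b) = {}"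
begin

abbreviation src :: "'b \<Rightarrow> complex" where "src a \<equiv> pathstart (c a)"
abbreviation tgt :: "'b \<Rightarrow> complex" where "tgt a \<equiv> pathfinish (c a)"
abbreviation circ :: "('b \<Rightarrow> int) \<Rightarrow> bool" where "circ \<equiv> circulation A src tgt"

definition net :: "'b set \<Rightarrow> complex set" where "net B = (\<Union>a\<in>B. path_image (c a))"

definition wind :: "('b \<Rightarrow> int) \<Rightarrow> complex \<Rightarrow> complex" where
  "wind f z = (\<Sum>a\<in>A. of_int (f a) * winding_number (c a) z)"

definition adj :: "'b set \<Rightarrow> (complex \<times> complex) set" where
  "adj B = (\<lambda>a. (src a, tgt a)) ` B \<union> (\<lambda>a. (tgt a, src a)) ` B"

lemma path_c: "a \<in> A \<Longrightarrow> path (c a)" using arc_c arc_imp_path by blast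

lemma src_ne_tgt: "a \<in> A \<Longrightarrow> src a \<noteq> tgt a" using arc_distinct_ends[OF arc_c] by metis

lemma net_mono: "B \<subseteq> B' \<Longrightarrow> net B \<subseteq> net B'" by (auto simp: net_def)

lemma net_insert: "net (insert e B) = path_image (c e) \<union> net B" by (simp add: net_def)

lemma compact_net: "B \<subseteq> A \<Longrightarrow> compact (net B)"
  unfolding net_def using finite_subset[OF _ finite_A] by (auto intro!: compact_UN compact_path_image path_c)

lemma sym_adj: "sym (adj B)" by (auto simp: adj_def sym_def)

lemma adj_mono: "B \<subseteq> B' \<Longrightarrow> adj B \<subseteq> adj B'" by (auto simp: adj_def)

lemma arcs_meet_at_ends:
  assumes "a \<in> A" "b \<in> A" "a \<noteq> b"
  shows "path_image (c a) \<inter> path_image (c b) \<subseteq> {src a, tgt a} \<inter> {src b, tgt b}"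
proof
  fix x assume x: "x \<in> path_image (c a) \<inter> path_image (c b)"
  then have "x \<notin> c a ` {0<..<1}" "x \<notin> c b ` {0<..<1}"
    using interior_no_crossing[OF assms] interior_no_crossing[OF assms(2,1)] assms(3) by auto
  with x show "x \<in> {src a, tgt a} \<inter> {src b, tgt b}"
    unfolding path_image_interior_ends[of "c a"] path_image_interior_ends[of "c b"] by simp
qed

lemma arc_meets_net:
  assumes "e \<in> A" "B \<subseteq> A" "e \<notin> B"
  shows "path_image (c e) \<inter> net B \<subseteq> {src e, tgt e}"
  using arcs_meet_at_ends[OF assms(1)] assms(2,3) unfolding net_def by blast

lemma vertex_on_arc: "a \<in> A \<Longrightarrow> v \<in> V \<Longrightarrow> v \<in> path_image (c a) \<Longrightarrow> v = src a \<or> v = tgt a"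
  using interior_no_vertex[of a] unfolding path_image_interior_ends[of "c a"] by auto

lemma arc_interior_disjoint_net:
  assumes "e \<in> A" "B \<subseteq> A" "e \<notin> B" shows "c e ` {0<..<1} \<inter> net B = {}"
  using interior_no_crossing[OF assms(1)] assms(2,3) unfolding net_def by blast

lemma wind_add: "wind (\<lambda>a. f a + g a) z = wind f z + wind g z"
  by (simp add: wind_def distrib_right sum.distrib)

lemma wind_cmult: "wind (\<lambda>a. k * f a) z = of_int k * wind f z"
  by (simp add: wind_def sum_distrib_left mult.assoc)

text \<open>The winding number of a single arc differs from an integer by a difference of the
  potential \<open>Ln (v - z) / (2 * pi * i)\<close> at its ends, and these differences cancel in a
  circulation. Arcs with \<open>f a = 0\<close> may pass through \<open>z\<close>; later this allows
  crossing an arc on which the circulation vanishes.\<close>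

lemma wind_Ints:
  assumes f: "circ f" and z: "z \<notin> net {a\<in>A. f a \<noteq> 0}"
  shows "wind f z \<in> \<int>"
proof -
  define L where "L v = Ln (v - z) / (2 * of_real pi * \<i>)" for v
  have *: "winding_number (c a) z + (L (src a) - L (tgt a)) \<in> \<int>" if a: "a \<in> A" "f a \<noteq> 0" for a
  proof -
    have za: "z \<notin> path_image (c a)" using z a by (auto simp: net_def)
    then have ne: "src a - z \<noteq> 0" "tgt a - z \<noteq> 0" by auto
    have eL: "exp (2 * of_real pi * \<i> * L v) = v - z" if "v - z \<noteq> 0" for v
      using that by (simp add: L_def)
    have "exp (2 * of_real pi * \<i> * (winding_number (c a) z + (L (src a) - L (tgt a))))
        = exp (2 * of_real pi * \<i> * winding_number (c a) z) * (src a - z) / (tgt a - z)"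
      by (simp add: distrib_left right_diff_distrib exp_add exp_diff eL[OF ne(1)] eL[OF ne(2)])
    also have "\<dots> = 1"
      using winding_number_exp_2pi[OF path_c[OF a(1)] za] ne by simp
    finally have "exp (2 * of_real pi * \<i> * (winding_number (c a) z + (L (src a) - L (tgt a)))) = 1" .
    then obtain n :: int where "2 * of_real pi * \<i> * (winding_number (c a) z + (L (src a) - L (tgt a)))
        = of_int (2 * n) * of_real pi * \<i>"
      unfolding exp_eq_1 by (metis complex_eq_iff complex_Re_of_int Re_complex_of_real Im_complex_of_real
          Re_i_times Im_i_times mult.commute of_real_of_int_eq of_real_mult neg_equal_0_iff_equal)
    then have "winding_number (c a) z + (L (src a) - L (tgt a)) = of_int n" by simp
    then show ?thesis by simp
  qed
  have "wind f z = (\<Sum>a\<in>A. of_int (f a) * winding_number (c a) z)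
      + (\<Sum>a\<in>A. of_int (f a) * (L (src a) - L (tgt a)))"
    using circulation_potential[OF finite_A f, of L] by (simp add: wind_def)
  also have "\<dots> = (\<Sum>a\<in>A. of_int (f a) * (winding_number (c a) z + (L (src a) - L (tgt a))))"
    by (simp add: distrib_left sum.distrib)
  also have "\<dots> \<in> \<int>"
  proof (rule Ints_sum)
    fix a assume "a \<in> A"
    then show "of_int (f a) * (winding_number (c a) z + (L (src a) - L (tgt a))) \<in> \<int>"
      using * by (cases "f a = 0") (auto intro: Ints_mult)
  qed
  finally show ?thesis .
qed

lemma wind_constant:
  assumes f: "circ f" and T: "connected T" "T \<inter> net {a\<in>A. f a \<noteq> 0} = {}"
    and z: "z \<in> T" "z' \<in> T"
  shows "wind f z = wind f z'"
proof -
  have int: "wind f y \<in> \<int>" if "y \<in> T" for y using wind_Ints[OF f] T(2) that by blast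
  have "continuous_on T (wind f)"
    unfolding wind_def[abs_def]
  proof (rule continuous_on_sum)
    fix a assume a: "a \<in> A"
    show "continuous_on T (\<lambda>y. of_int (f a) * winding_number (c a) y)"
    proof (cases "f a = 0")
      case False
      then have "T \<subseteq> - path_image (c a)" using T(2) a by (auto simp: net_def)
      then show ?thesis
        using continuous_on_subset[OF continuous_on_winding_number[OF path_c[OF a]]]
        by (intro continuous_intros) auto
    qed simp
  qed
  then have "wind f constant_on T"
  proof (rule continuous_discrete_range_constant[OF T(1)])
    fix y assume y: "y \<in> T"
    have "1 \<le> norm (wind f x - wind f y)" if x: "x \<in> T" "wind f x \<noteq> wind f y" for x
    proof -
      obtain k where k: "wind f x - wind f y = of_int k"
        using Ints_diff[OF int[OF x(1)] int[OF y]] Ints_cases by blast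
      then have "k \<noteq> 0" using x(2) by auto
      then show ?thesis unfolding k by simp
    qed
    then show "\<exists>e>0. \<forall>x. x \<in> T \<and> wind f x \<noteq> wind f y \<longrightarrow> e \<le> norm (wind f x - wind f y)"
      by (intro exI[of _ 1]) auto
  qed
  then show ?thesis using z by (auto simp: constant_on_def)
qed

section \<open>Simple paths and cycles of the drawing as Jordan arcs and Jordan curves\<close>

inductive dart :: "'b set \<Rightarrow> 'b \<Rightarrow> (real \<Rightarrow> complex) \<Rightarrow> complex \<Rightarrow> complex \<Rightarrow> int \<Rightarrow> bool" for B where
  "e \<in> B \<Longrightarrow> dart B e (c e) (src e) (tgt e) 1"
| "e \<in> B \<Longrightarrow> dart B e (reversepath (c e)) (tgt e) (src e) (-1)"

text \<open>A simple path grown at its end, with its vertices \<open>S\<close>, its arcs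
  \<open>E\<close>, the curve \<open>q\<close> along it and the unit flow \<open>f\<close> that it
  carries. It starts with a dart because a constant curve is not a Jordan arc.\<close>

inductive polyarc :: "'b set \<Rightarrow> complex \<Rightarrow> complex \<Rightarrow> complex set \<Rightarrow> 'b set \<Rightarrow> (real \<Rightarrow> complex)
    \<Rightarrow> ('b \<Rightarrow> int) \<Rightarrow> bool" for B x where
  single: "dart B e p x w s \<Longrightarrow> polyarc B x w {x, w} {e} p (\<lambda>a. if a = e then s else 0)"
| step: "polyarc B x y S E q f \<Longrightarrow> dart B e p y w s \<Longrightarrow> w \<notin> S \<Longrightarrow>
    polyarc B x w (insert w S) (insert e E) (q +++ p) (f(e := s))"

lemma dartD:
  assumes "dart B e p y w s" "B \<subseteq> A"
  shows "e \<in> B" "e \<in> A" "Path_Connected.arc p" "pathstart p = y" "pathfinish p = w" "path_image p = path_image (c e)"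
    "{y, w} = {src e, tgt e}" "y \<in> V" "w \<in> V"
    "s * (of_bool (src e = v) - of_bool (tgt e = v)) = of_bool (y = v) - of_bool (w = v)"
    "z \<notin> path_image (c e) \<Longrightarrow> winding_number p z = of_int s * winding_number (c e) z"
proof -
  have e: "e \<in> A" using assms by (auto elim: dart.cases)
  show "e \<in> B" "e \<in> A" "Path_Connected.arc p" "pathstart p = y" "pathfinish p = w" "path_image p = path_image (c e)"
    "{y, w} = {src e, tgt e}" "y \<in> V" "w \<in> V"
    "s * (of_bool (src e = v) - of_bool (tgt e = v)) = of_bool (y = v) - of_bool (w = v)"
    "z \<notin> path_image (c e) \<Longrightarrow> winding_number p z = of_int s * winding_number (c e) z"
    using assms(1) e arc_c[OF e] path_c[OF e] ends_in_V[OF e]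
    by (auto elim!: dart.cases simp: arc_reversepath winding_number_reversepath)
qed

lemma sum_fun_upd_int:
  fixes k :: "'b \<Rightarrow> 'c::comm_ring_1"
  assumes "e \<in> A" "f e = 0"
  shows "(\<Sum>a\<in>A. of_int ((f(e := s)) a) * k a) = (\<Sum>a\<in>A. of_int (f a) * k a) + of_int s * k e"
proof -
  have "(\<Sum>a\<in>A. of_int ((f(e := s)) a) * k a) = (\<Sum>a\<in>A. of_int (f a) * k a + (if a = e then of_int s * k e else 0))"
    using assms by (intro sum.cong) auto
  then show ?thesis using finite_A assms by (simp add: sum.distrib)
qed

text \<open>The point of the step is that the curve stays simple: a vertex lies on an arc only as
  one of its ends, so the new end \<open>w\<close>, being outside \<open>S\<close>, is not on the
  curve so far, and the added dart meets it only in \<open>y\<close>.\<close>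

lemma polyarcD:
  assumes "polyarc B x y S E q f" and BA: "B \<subseteq> A"
  shows "x \<in> S \<and> y \<in> S \<and> S \<subseteq> V \<and> E \<subseteq> B \<and> (\<forall>a\<in>E. src a \<in> S \<and> tgt a \<in> S) \<and>
    Path_Connected.arc q \<and> pathstart q = x \<and> pathfinish q = y \<and> path_image q = net E \<and>
    (\<forall>a. a \<notin> E \<longrightarrow> f a = 0) \<and>
    (\<forall>v. (\<Sum>a\<in>A. f a * (of_bool (src a = v) - of_bool (tgt a = v))) = of_bool (x = v) - of_bool (y = v)) \<and>
    (\<forall>z. z \<notin> net E \<longrightarrow> winding_number q z = wind f z)"
  using assms(1)
proof induction
  case (single e p w s)
  note d = dartD[OF single BA]
  have f: "(\<lambda>a. if a = e then s else 0) = (\<lambda>a. 0)(e := s)" by auto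
  have "(\<Sum>a\<in>A. (if a = e then s else 0) * (of_bool (src a = v) - of_bool (tgt a = v))) = of_bool (x = v) - of_bool (w = v)" for v
    using sum_fun_upd_int[OF d(2), of "\<lambda>a. 0" s "\<lambda>a. of_bool (src a = v) - of_bool (tgt a = v) :: int"] d(10)
    unfolding f[symmetric] by simp
  moreover have "wind (\<lambda>a. if a = e then s else 0) z = of_int s * winding_number (c e) z" for z
    unfolding f wind_def by (subst sum_fun_upd_int[OF d(2)]) auto
  moreover have "src e \<in> {x, w}" "tgt e \<in> {x, w}" using d(7) by auto
  ultimately show ?case using d ends_in_V[OF d(2)] by (auto simp: net_def)
next
  case (step y S E q f e p w s)
  note d = dartD[OF step(2) BA]
  have IH: "x \<in> S" "y \<in> S" "S \<subseteq> V" "E \<subseteq> B" "\<And>a. a \<in> E \<Longrightarrow> src a \<in> S \<and> tgt a \<in> S"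
    "Path_Connected.arc q" "pathstart q = x" "pathfinish q = y" "path_image q = net E" "\<And>a. a \<notin> E \<Longrightarrow> f a = 0"
    "\<And>v. (\<Sum>a\<in>A. f a * (of_bool (src a = v) - of_bool (tgt a = v))) = of_bool (x = v) - of_bool (y = v)"
    "\<And>z. z \<notin> net E \<Longrightarrow> winding_number q z = wind f z"
    using step.IH by blast+
  have "w \<in> {src e, tgt e}" using d(7) by blast
  then have eE: "e \<notin> E" using IH(5)[of e] step(3) by auto
  have EA: "E \<subseteq> A" using IH(4) BA by auto
  have wE: "w \<notin> net E" using vertex_on_arc[OF _ d(9)] IH(5) EA step(3) unfolding net_def by blast
  have "net E \<inter> path_image p \<subseteq> {y, w}" using arc_meets_net[OF d(2) EA eE] d(6,7) by auto
  then have meet: "path_image q \<inter> path_image p \<subseteq> {pathstart p}" using wE d(4) IH(9) by auto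
  have arc: "Path_Connected.arc (q +++ p)" using IH(6,8) d(3,4) meet by (intro arc_join) auto
  have f0: "f e = 0" using eE IH(10) by simp
  have ex: "(\<Sum>a\<in>A. (f(e := s)) a * (of_bool (src a = v) - of_bool (tgt a = v))) = of_bool (x = v) - of_bool (w = v)" for v
    using sum_fun_upd_int[where f = f and s = s, OF d(2) f0, of "\<lambda>a. of_bool (src a = v) - of_bool (tgt a = v) :: int"] 
      IH(11)[of v] d(10)[of v] by simp
  have wn: "winding_number (q +++ p) z = wind (f(e := s)) z" if "z \<notin> net (insert e E)" for z
  proof -
    have z: "z \<notin> net E" "z \<notin> path_image (c e)" using that by (auto simp: net_insert)
    have "winding_number (q +++ p) z = winding_number q z + winding_number p z"
      using IH(6,8,9) d(3,4,6) z by (intro winding_number_join) (auto simp: arc_imp_path)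
    then show ?thesis
      using IH(12)[OF z(1)] d(11)[OF z(2)] unfolding wind_def
      by (subst sum_fun_upd_int[where f = f, OF d(2) f0]) auto
  qed
  have "path_image (q +++ p) = net (insert e E)"
    using IH(8,9) d(4,6) by (subst path_image_join) (auto simp: net_insert)
  moreover have "{src e, tgt e} \<subseteq> insert w S" unfolding d(7)[symmetric] using IH(2) by auto
  moreover have "\<forall>a. a \<notin> insert e E \<longrightarrow> (f(e := s)) a = 0" using IH(10) by auto
  moreover have "\<forall>a\<in>insert e E. src a \<in> insert w S \<and> tgt a \<in> insert w S" using IH(5) calculation(2) by auto
  ultimately show ?case
    using arc IH(1,3,4,7) d(1,5,9) by (intro conjI allI impI ex wn) (assumption | simp | blast)+
qed

text \<open>This cuts a walk back when it returns to an earlier vertex.\<close>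

lemma polyarc_prefix:
  assumes "polyarc B x y S E q f" "w \<in> S" "w \<noteq> x"
  shows "\<exists>S E q f. polyarc B x w S E q f"
  using assms
proof (induction)
  case (single e p w' s)
  then show ?case using polyarc.single by (metis insertE singletonD)
next
  case (step y S E q f e p w' s)
  then show ?case using polyarc.step by (metis insertE)
qed

lemma polyarc_exists:
  assumes "(x, y) \<in> (adj B)\<^sup>*" "x \<noteq> y"
  shows "\<exists>S E q f. polyarc B x y S E q f"
  using assms
proof (induction rule: rtrancl_induct)
  case (step y w)
  obtain e p s where d: "dart B e p y w s"
    using step(2) unfolding adj_def by (auto intro: dart.intros)
  show ?case
  proof (cases "x = y")
    case True
    then show ?thesis using polyarc.single d by blast
  next
    case False
    then obtain S E q f where P: "polyarc B x y S E q f" using step by blast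
    show ?thesis
    proof (cases "w \<in> S")
      case True
      then show ?thesis using polyarc_prefix[OF P] step.prems by blast
    next
      case False
      then show ?thesis using polyarc.step[OF P d] by blast
    qed
  qed
qed simp

text \<open>\<open>f\<close> is the flow around the cycle and \<open>C\<close> its curve.
  Connectedness of the part of \<open>C\<close> in \<open>net B\<close> is recorded as the
  hypothesis of Janiszewski's theorem.\<close>

definition cycle_through :: "'b \<Rightarrow> 'b set \<Rightarrow> ('b \<Rightarrow> int) \<Rightarrow> (real \<Rightarrow> complex) \<Rightarrow> bool" where
  "cycle_through e B f C \<longleftrightarrow> circ f \<and> f e = 1 \<and> (\<forall>a. a \<notin> insert e B \<longrightarrow> f a = 0) \<and>
     simple_path C \<and> pathfinish C = pathstart C \<and> path_image (c e) \<subseteq> path_image C \<and>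
     path_image C \<subseteq> net (insert e B) \<and> connected (path_image C \<inter> net B) \<and>
     (\<forall>z. z \<notin> net (insert e B) \<longrightarrow> wind f z = winding_number C z)"

lemma cycle_through_exists:
  assumes e: "e \<in> A" and B: "B \<subseteq> A" "e \<notin> B" and conn: "(tgt e, src e) \<in> (adj B)\<^sup>*"
  shows "\<exists>f C. cycle_through e B f C"
proof -
  obtain S E q f where P: "polyarc B (tgt e) (src e) S E q f"
    using polyarc_exists[OF conn] src_ne_tgt[OF e] by metis
  have pa: "tgt e \<in> S" "src e \<in> S" "E \<subseteq> B" 
    "Path_Connected.arc q" "pathstart q = tgt e" "pathfinish q = src e" "path_image q = net E" "\<And>a. a \<notin> E \<Longrightarrow> f a = 0"
    "\<And>v. (\<Sum>a\<in>A. f a * (of_bool (src a = v) - of_bool (tgt a = v))) = of_bool (tgt e = v) - of_bool (src e = v)"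
    "\<And>z. z \<notin> net E \<Longrightarrow> winding_number q z = wind f z"
    using polyarcD[OF P B(1)] by blast+
  have f0: "f e = 0" using pa(3,8) B(2) by blast
  define C where "C = c e +++ q"
  define g where "g = f(e := 1)"
  have qB: "path_image q \<subseteq> net B" using pa(3,7) net_mono by blast
  have meet: "path_image (c e) \<inter> net B \<subseteq> {src e, tgt e}" by (rule arc_meets_net[OF e B])
  have im: "path_image C = path_image (c e) \<union> path_image q"
    unfolding C_def using pa(5) by (intro path_image_join) simp
  have "simple_path C" unfolding C_def
    using arc_c[OF e] pa(4-6) meet qB by (intro simple_path_join_loop) auto
  moreover have "pathfinish C = pathstart C" by (simp add: C_def pa(6))
  moreover have "path_image C \<inter> net B = path_image q"
  proof -
    have "{src e, tgt e} \<subseteq> path_image q" using pa(5,6) by (metis insert_subset empty_subsetI pathfinish_in_path_image pathstart_in_path_image)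
    then show ?thesis using im meet qB by blast
  qed
  moreover have "connected (path_image q)" using pa(4) by (simp add: arc_imp_path connected_path_image)
  moreover have "circ g"
    unfolding circulation_def g_def
  proof
    fix v
    show "(\<Sum>a\<in>A. (f(e := 1)) a * (of_bool (src a = v) - of_bool (tgt a = v))) = 0"
      using sum_fun_upd_int[where f = f and s = 1, OF e f0, of "\<lambda>a. of_bool (src a = v) - of_bool (tgt a = v) :: int"] 
        pa(9)[of v] by simp
  qed
  moreover have "wind g z = winding_number C z" if "z \<notin> net (insert e B)" for z
  proof -
    have z: "z \<notin> net E" "z \<notin> path_image (c e)" using that net_mono[OF pa(3)] by (auto simp: net_insert)
    have "winding_number C z = winding_number (c e) z + winding_number q z" unfolding C_def
      using pa(4,5,7) z path_c[OF e] by (intro winding_number_join) (auto simp: arc_imp_path)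
    then show ?thesis
      using pa(10)[OF z(1)] unfolding wind_def g_def
      by (subst sum_fun_upd_int[where f = f, OF e f0]) auto
  qed
  moreover have "g e = 1" "\<forall>a. a \<notin> insert e B \<longrightarrow> g a = 0" using pa(3,8) by (auto simp: g_def)
  ultimately have "cycle_through e B g C"
    using im qB unfolding cycle_through_def by (auto simp: net_insert)
  then show ?thesis by blast
qed

section \<open>Faces of subdrawings, and which points an added arc separates\<close>

definition sim :: "'b set \<Rightarrow> complex \<Rightarrow> complex \<Rightarrow> bool" where
  "sim B = connected_component (- net B)"

lemma sim_refl: "z \<notin> net A \<Longrightarrow> B \<subseteq> A \<Longrightarrow> sim B z z"
  using net_mono by (auto simp: sim_def)

lemma sim_sym: "sim B z z' \<Longrightarrow> sim B z' z"
  by (simp add: sim_def connected_component_sym)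

lemma sim_trans: "sim B z z' \<Longrightarrow> sim B z' z'' \<Longrightarrow> sim B z z''"
  unfolding sim_def by (rule connected_component_trans)

lemma sim_antimono: "sim B z z' \<Longrightarrow> B' \<subseteq> B \<Longrightarrow> sim B' z z'"
  unfolding sim_def using net_mono connected_component_mono
  by (metis Compl_subset_Compl_iff subsetD mem_Collect_eq connected_component_of_subset)

lemma sim_wind:
  assumes "circ f" "\<And>a. a \<notin> B \<Longrightarrow> f a = 0" "sim B z z'"
  shows "wind f z = wind f z'"
proof -
  obtain T where T: "connected T" "T \<subseteq> - net B" "z \<in> T" "z' \<in> T"
    using assms(3) by (auto simp: sim_def connected_component_def)
  have "net {a\<in>A. f a \<noteq> 0} \<subseteq> net B" using assms(2) by (intro net_mono) auto
  then show ?thesis using wind_constant[OF assms(1) T(1)] T by blast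
qed

lemma reachable_ends_iff:
  assumes "a \<in> B"
  shows "(u, src a) \<in> (adj B)\<^sup>* \<longleftrightarrow> (u, tgt a) \<in> (adj B)\<^sup>*"
proof -
  have "(src a, tgt a) \<in> adj B" "(tgt a, src a) \<in> adj B" using assms by (auto simp: adj_def)
  then show ?thesis by (auto intro: rtrancl_into_rtrancl)
qed

text \<open>Split \<open>B\<close> into the component of \<open>src e\<close> and the rest. The
  first part meets the arc in at most \<open>src e\<close>, and their union meets the rest in at
  most \<open>tgt e\<close>. An arc does not separate the plane, so Janiszewski's theorem applies
  twice, each time with an intersection of at most one point.\<close>

lemma bridge_no_separation:
  assumes e: "e \<in> A" and B: "B \<subseteq> A" "e \<notin> B" and nc: "(src e, tgt e) \<notin> (adj B)\<^sup>*"
    and s: "sim B z z'" and z: "z \<notin> path_image (c e)" "z' \<notin> path_image (c e)"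
  shows "sim (insert e B) z z'"
proof -
  define R where "R = {v. (src e, v) \<in> (adj B)\<^sup>*}"
  define B1 where "B1 = {a\<in>B. src a \<in> R}"
  define B2 where "B2 = {a\<in>B. src a \<notin> R}"
  have R: "src a \<in> R \<longleftrightarrow> tgt a \<in> R" if "a \<in> B" for a
    using reachable_ends_iff[OF that] by (simp add: R_def)
  have uv: "src e \<in> R" "tgt e \<notin> R" using nc by (auto simp: R_def)
  have B1A: "B1 \<subseteq> A" "B2 \<subseteq> A" "e \<notin> B1" "e \<notin> B2" "B1 \<union> B2 = B" using B by (auto simp: B1_def B2_def)
  have V: "src e \<in> V" "tgt e \<in> V" using ends_in_V[OF e] by auto
  have "tgt e \<notin> net B1"
  proof
    assume "tgt e \<in> net B1"
    then obtain a where a: "a \<in> B1" "tgt e \<in> path_image (c a)" by (auto simp: net_def)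
    then have "tgt e = src a \<or> tgt e = tgt a" using vertex_on_arc V B1A by blast
    then show False using a R uv by (auto simp: B1_def)
  qed
  then have 1: "net B1 \<inter> path_image (c e) \<subseteq> {src e}" using arc_meets_net[OF e B1A(1,3)] by auto
  have "src e \<notin> net B2"
  proof
    assume "src e \<in> net B2"
    then obtain a where a: "a \<in> B2" "src e \<in> path_image (c a)" by (auto simp: net_def)
    then have "src e = src a \<or> src e = tgt a" using vertex_on_arc V B1A by blast
    then show False using a R uv by (auto simp: B2_def)
  qed
  moreover have "net B1 \<inter> net B2 = {}"
  proof (rule ccontr)
    assume "net B1 \<inter> net B2 \<noteq> {}"
    then obtain x a b where x: "a \<in> B1" "b \<in> B2" "x \<in> path_image (c a)" "x \<in> path_image (c b)"
      by (auto simp: net_def)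
    then have "a \<noteq> b" by (auto simp: B1_def B2_def)
    then have "x \<in> {src a, tgt a} \<inter> {src b, tgt b}" using arcs_meet_at_ends[of a b] x B1A by blast
    then show False using x(1,2) R by (auto simp: B1_def B2_def)
  qed
  ultimately have 2: "(net B1 \<union> path_image (c e)) \<inter> net B2 \<subseteq> {tgt e}"
    using arc_meets_net[OF e B1A(2,4)] by auto
  have ce: "connected_component (- path_image (c e)) z z'"
    unfolding connected_component_def using connected_arc_complement[OF arc_c[OF e]] z
    by (intro exI[of _ "- path_image (c e)"]) auto
  have s1: "connected_component (- net B1) z z'" and s2: "connected_component (- net B2) z z'"
    using sim_antimono[OF s] B1A(5) by (auto simp: sim_def)
  have "connected_component (- (net B1 \<union> path_image (c e))) z z'"
    by (rule Janiszewski[OF compact_net[OF B1A(1)] _ connected_subset_singleton[OF 1] s1 ce])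
      (simp add: closed_path_image path_c e)
  then have "connected_component (- ((net B1 \<union> path_image (c e)) \<union> net B2)) z z'"
    using compact_net[OF B1A(1)] compact_net[OF B1A(2)] compact_path_image[OF path_c[OF e]]
    by (intro Janiszewski[OF _ _ connected_subset_singleton[OF 2] _ s2]) (auto intro: compact_imp_closed)
  moreover have "(net B1 \<union> path_image (c e)) \<union> net B2 = net (insert e B)"
    using B1A(5) by (auto simp: net_def)
  ultimately show ?thesis by (simp add: sim_def)
qed

text \<open>The winding number vanishes outside a Jordan curve and not inside, and both sides are
  connected.\<close>

lemma same_winding_same_side:
  assumes C: "simple_path C" "pathfinish C = pathstart C"
    and z: "z \<notin> path_image C" "z' \<notin> path_image C" and w: "winding_number C z = winding_number C z'"
  shows "connected_component (- path_image C) z z'"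
proof -
  note J = Jordan_inside_outside[OF C]
  have out: "winding_number C x = 0" if "x \<in> outside (path_image C)" for x
    using winding_number_zero_in_outside[OF simple_path_imp_path[OF C(1)] C(2) that] .
  have "winding_number C x \<noteq> 0" if "x \<in> inside (path_image C)" for x
    using simple_closed_path_norm_winding_number_inside[OF C(1) that] by auto
  then have "z \<in> inside (path_image C) \<and> z' \<in> inside (path_image C)
      \<or> z \<in> outside (path_image C) \<and> z' \<in> outside (path_image C)"
    using inside_Un_outside[of "path_image C"] z w out by (metis ComplI UnE)
  moreover have "connected (inside (path_image C))" "connected (outside (path_image C))"
    using J by blast+
  moreover have "inside (path_image C) \<subseteq> - path_image C" "outside (path_image C) \<subseteq> - path_image C"
    using inside_Un_outside[of "path_image C"] by blast+
  ultimately show ?thesis unfolding connected_component_def by metis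
qed

text \<open>Equal winding numbers put both points on the same side of \<open>C\<close>, and
  \<open>C\<close> meets \<open>net B\<close> in a connected set; so Janiszewski's theorem applies
  to these two sets.\<close>

lemma cycle_no_separation:
  assumes e: "e \<in> A" and B: "B \<subseteq> A" and C: "cycle_through e B f C"
    and s: "sim B z z'" and z: "z \<notin> net (insert e B)" "z' \<notin> net (insert e B)"
    and w: "wind f z = wind f z'"
  shows "sim (insert e B) z z'"
proof -
  note D = C[unfolded cycle_through_def]
  have "connected_component (- path_image C) z z'"
    using D z w by (intro same_winding_same_side) auto
  moreover have "compact (path_image C)" using D by (simp add: simple_path_imp_path compact_path_image)
  ultimately have "connected_component (- (path_image C \<union> net B)) z z'"
    using D s by (intro Janiszewski compact_imp_closed[OF compact_net[OF B]]) (auto simp: sim_def)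
  moreover have "path_image C \<union> net B = net (insert e B)" using D by (auto simp: net_insert)
  ultimately show ?thesis by (simp add: sim_def)
qed

lemma bridge_circulation_zero:
  assumes f: "circ f" and e: "e \<in> A" and nc: "(src e, tgt e) \<notin> (adj (A - {e}))\<^sup>*"
  shows "f e = 0"
proof -
  define R where "R = {v. (src e, v) \<in> (adj (A - {e}))\<^sup>*}"
  have R: "src a \<in> R \<longleftrightarrow> tgt a \<in> R" if "a \<in> A" "a \<noteq> e" for a
    using reachable_ends_iff[of a "A - {e}" "src e"] that by (simp add: R_def)
  have "src e \<in> R" "tgt e \<notin> R" using nc by (auto simp: R_def)
  then have "(\<Sum>a\<in>A. of_int (f a) * (of_bool (src a \<in> R) - of_bool (tgt a \<in> R))) = (\<Sum>a\<in>A. if a = e then f e else 0)"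
    using R by (intro sum.cong) auto
  then show ?thesis
    using circulation_potential[OF finite_A f, of "\<lambda>v. of_bool (v \<in> R) :: int"] finite_A e by simp
qed

text \<open>The points \<open>zl a\<close> and \<open>zr a\<close> lie to the left and to the right of the arc \<open>a\<close>; for a bridge \<open>a\<close>
  they are one and the same arbitrary point.\<close>

definition side_points :: "('b \<Rightarrow> complex) \<Rightarrow> ('b \<Rightarrow> complex) \<Rightarrow> bool" where
  "side_points zl zr \<longleftrightarrow> (\<forall>a\<in>A. zl a \<notin> net A \<and> zr a \<notin> net A \<and>
     (\<forall>f. circ f \<longrightarrow> wind f (zl a) - wind f (zr a) = of_int (f a)) \<and>
     (zl a = zr a \<or> sim (A - {a}) (zl a) (c a (1/2)) \<and> sim (A - {a}) (zr a) (c a (1/2))))"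

section \<open>The two sides of an arc\<close>

lemma net_complement_nonempty: "\<exists>z. z \<notin> net A"
  using compact_net[OF subset_refl] compact_imp_bounded not_bounded_UNIV by (metis UNIV_eq_I)

text \<open>Off a Jordan curve there are only two winding numbers, 0 and one of 1 and -1; points
  that differ by 1 exhibit both.\<close>

lemma cycle_value_difference:
  assumes C: "cycle_through e B f C" and z: "z \<notin> net (insert e B)" "z' \<notin> net (insert e B)" "z'' \<notin> net (insert e B)"
    and d: "wind f z - wind f z' = 1"
  shows "wind f z'' = wind f z \<or> wind f z'' = wind f z'"
proof -
  note D = C[unfolded cycle_through_def]
  have val: "wind f x = 0 \<or> wind f x = k" if "\<And>z. z \<in> inside (path_image C) \<Longrightarrow> winding_number C z = k"
    "x \<notin> net (insert e B)" for x k
  proof -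
    have "x \<notin> path_image C" using D that(2) by blast
    then have "x \<in> inside (path_image C) \<or> x \<in> outside (path_image C)"
      using inside_Un_outside[of "path_image C"] by blast
    moreover have "wind f x = winding_number C x" using D that(2) by blast
    ultimately show ?thesis
      using that(1) winding_number_zero_in_outside[of C x] D simple_path_imp_path[of C] by metis
  qed
  show ?thesis
  proof (rule simple_closed_path_winding_number_inside[of C])
    show "simple_path C" using D by blast
  next
    assume "\<And>z. z \<in> inside (path_image C) \<Longrightarrow> winding_number C z = 1"
    from val[OF this z(1)] val[OF this z(2)] val[OF this z(3)] d show ?thesis by auto
  next
    assume "\<And>z. z \<in> inside (path_image C) \<Longrightarrow> winding_number C z = -1"
    from val[OF this z(1)] val[OF this z(2)] val[OF this z(3)] d show ?thesis by auto
  qed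
qed

text \<open>Both points are taken from a ball around the midpoint of \<open>a\<close> that misses
  all other arcs, one inside and one outside \<open>C\<close>. The sign of the winding number inside
  decides which of them is the left one.\<close>

lemma side_points_cycle:
  assumes a: "a \<in> A" and C: "cycle_through a (A - {a}) g C"
  shows "\<exists>x y. x \<notin> net A \<and> y \<notin> net A \<and> (\<forall>f. circ f \<longrightarrow> wind f x - wind f y = of_int (f a)) \<and>
     sim (A - {a}) x (c a (1/2)) \<and> sim (A - {a}) y (c a (1/2))"
proof -
  have A: "insert a (A - {a}) = A" using a by auto
  note D = C[unfolded cycle_through_def A]
  note J = Jordan_inside_outside[of C]
  define m where "m = c a (1/2)"
  have m: "m \<in> c a ` {0<..<1}" by (auto simp: m_def)
  have "m \<in> - net (A - {a})" using arc_interior_disjoint_net[OF a, of "A - {a}"] m by auto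
  moreover have "open (- net (A - {a}))" using compact_net[of "A - {a}"] by (auto intro: compact_imp_closed)
  ultimately obtain \<epsilon> where \<epsilon>: "\<epsilon> > 0" "ball m \<epsilon> \<subseteq> - net (A - {a})" using open_contains_ball by blast
  have "m \<in> path_image (c a)" using m by (auto simp: path_image_def)
  then have mC: "m \<in> path_image C" using D by blast
  \<comment> \<open>By the Jordan curve theorem the whole curve is the frontier of either side, so
    both sides come arbitrarily close to \<open>m\<close>.\<close>
  have pt: "\<exists>x. x \<in> S \<and> x \<in> ball m \<epsilon>" if "frontier S = path_image C" for S
  proof -
    have "m \<in> closure S" using that mC by (auto simp: frontier_def)
    then show ?thesis using \<epsilon>(1) by (auto simp: closure_approachable dist_commute)
  qed
  obtain i where i: "i \<in> inside (path_image C)" "i \<in> ball m \<epsilon>" using pt[of "inside (path_image C)"] J D by auto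
  obtain u where u: "u \<in> outside (path_image C)" "u \<in> ball m \<epsilon>" using pt[of "outside (path_image C)"] J D by auto
  have off: "x \<notin> net A" if "x \<in> ball m \<epsilon>" "x \<notin> path_image C" for x
    using that \<epsilon>(2) D net_insert[of a "A - {a}"] unfolding A by blast
  have ni: "i \<notin> path_image C" "u \<notin> path_image C"
    using i(1) u(1) inside_Un_outside[of "path_image C"] by blast+
  have ball_sim: "sim (A - {a}) x m" if "x \<in> ball m \<epsilon>" for x
    unfolding sim_def connected_component_def using that \<epsilon> by (intro exI[of _ "ball m \<epsilon>"]) auto
  have u0: "wind g u = 0" using D u off[OF u(2) ni(2)] winding_number_zero_in_outside[of C u] simple_path_imp_path[of C]
    by metis
  have gi: "wind g i = winding_number C i" using D off[OF i(2) ni(1)] by blast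
  have key: "wind f x - wind f y = of_int (f a)"
    if xy: "x \<in> ball m \<epsilon>" "y \<in> ball m \<epsilon>" "wind g x - wind g y = 1" and f: "circ f" for f x y
  proof -
    \<comment> \<open>Subtracting \<open>f a\<close> times the cycle flow cancels \<open>f\<close>
      on \<open>a\<close>. The support of \<open>h\<close> then avoids the whole ball, so
      \<open>wind h\<close> is the same on both sides of \<open>a\<close>, and all of the jump of
      \<open>wind f\<close> comes from \<open>g\<close>.\<close>
    define h where "h b = f b + (- f a) * g b" for b
    have h: "circ h" unfolding h_def using f D by (intro circulation_add circulation_cmult) auto
    have "h a = 0" using D by (simp add: h_def)
    then have "net {b\<in>A. h b \<noteq> 0} \<subseteq> net (A - {a})" by (intro net_mono) auto
    then have "wind h x = wind h y" using \<epsilon>(2) xy by (intro wind_constant[OF h, of "ball m \<epsilon>"]) auto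
    then have "wind f x + of_int (- f a) * wind g x = wind f y + of_int (- f a) * wind g y"
      unfolding h_def wind_add wind_cmult .
    then have "wind f x - wind f y = of_int (f a) * (wind g x - wind g y)" by (simp add: algebra_simps)
    then show ?thesis using xy(3) by simp
  qed
  show ?thesis
  proof (rule simple_closed_path_winding_number_inside[of C])
    show "simple_path C" using D by blast
  next
    assume "\<And>z. z \<in> inside (path_image C) \<Longrightarrow> winding_number C z = 1"
    then have "wind g i - wind g u = 1" using u0 gi i(1) by simp
    then show ?thesis
      using key[OF i(2) u(2)] off[OF i(2) ni(1)] off[OF u(2) ni(2)] ball_sim i u unfolding m_def by metis
  next
    assume "\<And>z. z \<in> inside (path_image C) \<Longrightarrow> winding_number C z = -1"
    then have "wind g u - wind g i = 1" using u0 gi i(1) by simp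
    then show ?thesis
      using key[OF u(2) i(2)] off[OF i(2) ni(1)] off[OF u(2) ni(2)] ball_sim i u unfolding m_def by metis
  qed
qed

lemma side_points_exist: "\<exists>zl zr. side_points zl zr"
proof -
  obtain z0 where z0: "z0 \<notin> net A" using net_complement_nonempty by blast
  have "\<exists>p. fst p \<notin> net A \<and> snd p \<notin> net A \<and>
     (\<forall>f. circ f \<longrightarrow> wind f (fst p) - wind f (snd p) = of_int (f a)) \<and>
     (fst p = snd p \<or> sim (A - {a}) (fst p) (c a (1/2)) \<and> sim (A - {a}) (snd p) (c a (1/2)))"
    if a: "a \<in> A" for a
  proof (cases "(src a, tgt a) \<in> (adj (A - {a}))\<^sup>*")
    case True
    then have "(tgt a, src a) \<in> (adj (A - {a}))\<^sup>*"
      using sym_rtrancl[OF sym_adj] by (auto simp: sym_def)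
    then obtain g C where "cycle_through a (A - {a}) g C" using cycle_through_exists[OF a] by blast
    from side_points_cycle[OF a this] show ?thesis by auto
  next
    case False
    then show ?thesis using bridge_circulation_zero[OF _ a False] z0
      by (intro exI[of _ "(z0, z0)"]) auto
  qed
  then obtain p where p: "\<And>a. a \<in> A \<Longrightarrow> fst (p a) \<notin> net A \<and> snd (p a) \<notin> net A \<and>
     (\<forall>f. circ f \<longrightarrow> wind f (fst (p a)) - wind f (snd (p a)) = of_int (f a)) \<and>
     (fst (p a) = snd (p a) \<or> sim (A - {a}) (fst (p a)) (c a (1/2)) \<and> sim (A - {a}) (snd (p a)) (c a (1/2)))"
    by metis
  show ?thesis
    by (intro exI[of _ "\<lambda>a. fst (p a)"] exI[of _ "\<lambda>a. snd (p a)"]) (use p in \<open>auto simp: side_points_def\<close>)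
qed

text \<open>The topological content of the three inductions on arcs that follow. A bridge changes no
  face; any other arc runs inside one face of \<open>B\<close>, the one containing
  \<open>zl e\<close>, and cuts it into the sides of \<open>zl e\<close> and
  \<open>zr e\<close>.\<close>

lemma add_arc_cases:
  assumes e: "e \<in> A" and B: "B \<subseteq> A" "e \<notin> B" and sp: "side_points zl zr"
  obtains (bridge) "(src e, tgt e) \<notin> (adj B)\<^sup>*"
      "\<And>z z'. z \<notin> net A \<Longrightarrow> z' \<notin> net A \<Longrightarrow> sim B z z' \<Longrightarrow> sim (insert e B) z z'"
      "sim (insert e B) (zl e) (zr e)"
  | (split) f where "(src e, tgt e) \<in> (adj B)\<^sup>*" "circ f" "f e = 1" "\<And>a. a \<notin> insert e B \<Longrightarrow> f a = 0"
      "sim B (zl e) (zr e)"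
      "\<And>z z'. z \<notin> net A \<Longrightarrow> z' \<notin> net A \<Longrightarrow> sim B z z' \<Longrightarrow> sim (insert e B) z z' \<or> sim B z (zl e)"
      "\<And>z. z \<notin> net A \<Longrightarrow> sim B z (zl e) \<Longrightarrow> sim (insert e B) z (zl e) \<or> sim (insert e B) z (zr e)"
proof -
  have zs: "zl e \<notin> net A" "zr e \<notin> net A" using sp e by (auto simp: side_points_def)
  have eq: "zl e = zr e \<or> sim B (zl e) (c e (1/2)) \<and> sim B (zr e) (c e (1/2))"
  proof -
    have "B \<subseteq> A - {e}" using B by blast
    moreover have "zl e = zr e \<or> sim (A - {e}) (zl e) (c e (1/2)) \<and> sim (A - {e}) (zr e) (c e (1/2))"
      using sp e by (simp add: side_points_def)
    ultimately show ?thesis using sim_antimono by blast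
  qed
  then have "sim B (zl e) (zr e)"
    using sim_refl[OF zs(1) B(1)] sim_trans[of B "zl e" "c e (1/2)" "zr e"] sim_sym[of B "zr e"] by auto
  have eB: "insert e B \<subseteq> A" using e B by auto
  have offA: "z \<notin> net (insert e B)" if "z \<notin> net A" for z using that net_mono[OF eB] by blast
  have offe: "z \<notin> path_image (c e)" if "z \<notin> net A" for z using offA[OF that] by (simp add: net_insert)
  show thesis
  proof (cases "(src e, tgt e) \<in> (adj B)\<^sup>*")
    case False
    show thesis
    proof (rule bridge[OF False])
      show "sim (insert e B) z z'" if "z \<notin> net A" "z' \<notin> net A" "sim B z z'" for z z'
        using bridge_no_separation[OF e B False that(3)] offe that by blast
      then show "sim (insert e B) (zl e) (zr e)" using \<open>sim B (zl e) (zr e)\<close> zs by blast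
    qed
  next
    case True
    then have "(tgt e, src e) \<in> (adj B)\<^sup>*"
      using sym_rtrancl[OF sym_adj] by (auto simp: sym_def)
    then obtain f C where C: "cycle_through e B f C" using cycle_through_exists[OF e B] by blast
    note D = C[unfolded cycle_through_def]
    have f: "circ f" "f e = 1" "\<And>a. a \<notin> insert e B \<Longrightarrow> f a = 0" using D by auto
    have jump: "wind f (zl e) - wind f (zr e) = 1" using sp e f by (auto simp: side_points_def)
    \<comment> \<open>The jump excludes the degenerate choice \<open>zl e = zr e\<close>.\<close>
    then have le: "sim B (zl e) (c e (1/2))" using eq by auto
    show thesis
    proof (rule split[OF True f \<open>sim B (zl e) (zr e)\<close>])
      fix z assume z: "z \<notin> net A" "sim B z (zl e)"
      have "wind f z = wind f (zl e) \<or> wind f z = wind f (zr e)"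
        by (rule cycle_value_difference[OF C offA offA offA jump]) (use zs z in auto)
      then show "sim (insert e B) z (zl e) \<or> sim (insert e B) z (zr e)"
        using cycle_no_separation[OF e B(1) C, of z "zl e"] cycle_no_separation[OF e B(1) C, of z "zr e"]
          z offA zs \<open>sim B (zl e) (zr e)\<close> sim_trans by blast
    next
      fix z z' assume z: "z \<notin> net A" "z' \<notin> net A" "sim B z z'"
      show "sim (insert e B) z z' \<or> sim B z (zl e)"
      proof (cases "sim B z (zl e)")
        case False
        \<comment> \<open>A face of \<open>B\<close> that meets the arc is open and so meets its
          interior; this interior is connected, avoids \<open>net B\<close> and contains the
          midpoint, which lies in the face of \<open>zl e\<close>. So every other face survives
          unchanged.\<close>
        define T where "T = connected_component_set (- net B) z"
        have zT: "z \<in> T" "z' \<in> T" using z sim_refl[OF z(1) B(1)] by (auto simp: T_def sim_def)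
        have "T \<inter> path_image (c e) = {}"
        proof (rule ccontr)
          assume "T \<inter> path_image (c e) \<noteq> {}"
          moreover have "open T" using compact_net[OF B(1)] unfolding T_def
            by (intro open_connected_component) (auto intro: compact_imp_closed)
          ultimately have "T \<inter> c e ` {0<..<1} \<noteq> {}"
            using path_image_subset_closure_interior[OF path_c[OF e]] open_Int_closure_eq_empty[of T] by blast
          then obtain x where x: "x \<in> T" "x \<in> c e ` {0<..<1}" by blast
          have "connected (c e ` {0<..<1})"
            using path_c[OF e] unfolding path_def
            by (intro connected_continuous_image) (auto elim: continuous_on_subset)
          moreover have "c e (1/2) \<in> c e ` {0<..<1}" by auto
          ultimately have "sim B x (c e (1/2))"
            using x(2) arc_interior_disjoint_net[OF e B] unfolding sim_def connected_component_def by blast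
          moreover have "sim B z x" using x(1) by (simp add: T_def sim_def)
          ultimately show False using False le sim_trans sim_sym by blast
        qed
        moreover have "T \<subseteq> - net B" by (simp add: T_def connected_component_subset)
        ultimately have "T \<subseteq> - net (insert e B)" by (auto simp: net_insert)
        moreover have "connected T" by (simp add: T_def)
        ultimately show ?thesis using zT by (auto simp: sim_def connected_component_def)
      qed simp
    qed
  qed
qed

section \<open>Functions on faces and their coboundaries\<close>

definition face_invariant :: "'b set \<Rightarrow> (complex \<Rightarrow> int) \<Rightarrow> bool" where
  "face_invariant B h \<longleftrightarrow> (\<forall>z z'. z \<notin> net A \<longrightarrow> z' \<notin> net A \<longrightarrow> sim B z z' \<longrightarrow> h z = h z')"

definition iwind :: "('b \<Rightarrow> int) \<Rightarrow> complex \<Rightarrow> int" where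
  "iwind f z = \<lfloor>Re (wind f z)\<rfloor>"

lemma iwind_eq: "circ f \<Longrightarrow> z \<notin> net A \<Longrightarrow> of_int (iwind f z) = wind f z"
proof -
  assume "circ f" "z \<notin> net A"
  moreover have "net {a\<in>A. f a \<noteq> 0} \<subseteq> net A" by (intro net_mono) auto
  ultimately have "wind f z \<in> \<int>" using wind_Ints[of f z] by blast
  then show ?thesis unfolding iwind_def by (auto elim!: Ints_cases)
qed

lemma iwind_sides:
  assumes "side_points zl zr" "circ f" "a \<in> A"
  shows "iwind f (zl a) - iwind f (zr a) = f a"
proof -
  have "zl a \<notin> net A" "zr a \<notin> net A" "wind f (zl a) - wind f (zr a) = of_int (f a)"
    using assms by (auto simp: side_points_def)
  then have "of_int (iwind f (zl a) - iwind f (zr a)) = (of_int (f a) :: complex)"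
    using iwind_eq[OF assms(2)] by simp
  then show ?thesis by (simp only: of_int_eq_iff)
qed

lemma iwind_sim:
  assumes "circ f" "\<And>a. a \<notin> B \<Longrightarrow> f a = 0" "sim B z z'"
  shows "iwind f z = iwind f z'"
  using sim_wind[OF assms] by (simp add: iwind_def)

text \<open>Across a bridge \<open>h\<close> does not jump, so the arc can be erased. Otherwise
  \<open>f\<close> is a circulation with \<open>f e = 1\<close>, and subtracting
  \<open>d * iwind f\<close> removes the jump \<open>d\<close> of \<open>h\<close> across
  \<open>e\<close>. The remainder no longer sees \<open>e\<close>, and the part subtracted has
  coboundary \<open>d * f\<close>, a circulation as well.\<close>

lemma coboundary_circulation:
  assumes sp: "side_points zl zr" and B: "B \<subseteq> A" and h: "face_invariant B h"
  shows "circ (\<lambda>a. if a \<in> B then h (zl a) - h (zr a) else 0)"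
  using finite_subset[OF B finite_A] B h
proof (induction B arbitrary: h rule: finite_induct)
  case empty
  show ?case by (simp add: circulation_def)
next
  case (insert e B)
  have e: "e \<in> A" and B: "B \<subseteq> A" using insert.prems by auto
  have zs: "zl e \<notin> net A" "zr e \<notin> net A" using sp e by (auto simp: side_points_def)
  have inv: "h z = h z'" if "z \<notin> net A" "z' \<notin> net A" "sim (insert e B) z z'" for z z'
    using insert.prems(2) that by (auto simp: face_invariant_def)
  show ?case
  proof (cases rule: add_arc_cases[OF e B insert.hyps(2) sp, case_names bridge split])
    case bridge
    have "face_invariant B h" using bridge(2) inv by (auto simp: face_invariant_def)
    then have "circ (\<lambda>a. if a \<in> B then h (zl a) - h (zr a) else 0)" by (rule insert.IH[OF B])
    moreover have "h (zl e) = h (zr e)" using inv zs bridge(3) by blast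
    ultimately show ?thesis
      by (subst circulation_cong[where g = "\<lambda>a. if a \<in> B then h (zl a) - h (zr a) else 0"]) auto
  next
    case (split f)
    define d where "d = h (zl e) - h (zr e)"
    define h2 where "h2 z = h z - d * iwind f z" for z
    note jump = iwind_sides[OF sp split(2)]
    have eq: "h2 z = h2 z'" if "z \<notin> net A" "z' \<notin> net A" "sim (insert e B) z z'" for z z'
      using inv[OF that] iwind_sim[OF split(2,4) that(3)] by (simp add: h2_def)
    have lr: "h2 (zl e) = h2 (zr e)"
    proof -
      have "iwind f (zl e) = iwind f (zr e) + 1" using jump[OF e] split(3) by simp
      then show ?thesis by (simp add: h2_def d_def algebra_simps)
    qed
    have "h2 z = h2 z'" if z: "z \<notin> net A" "z' \<notin> net A" "sim B z z'" for z z'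
    proof (cases "sim (insert e B) z z'")
      case False
      then have "sim B z (zl e)" using split(6) z by blast
      moreover from this have "sim B z' (zl e)" using z(3) sim_sym sim_trans by blast
      ultimately have "h2 z = h2 (zl e)" "h2 z' = h2 (zl e)"
        using split(7) eq z zs lr by metis+
      then show ?thesis by simp
    qed (use eq z in blast)
    then have "face_invariant B h2" by (auto simp: face_invariant_def)
    then have "circ (\<lambda>a. (if a \<in> B then h2 (zl a) - h2 (zr a) else 0) + d * f a)"
      by (intro circulation_add circulation_cmult insert.IH[OF B] split(2))
    moreover have "(if a \<in> insert e B then h (zl a) - h (zr a) else 0)
        = (if a \<in> B then h2 (zl a) - h2 (zr a) else 0) + d * f a" if a: "a \<in> A" for a
    proof (cases "a \<in> B")
      case True
      have "iwind f (zl a) = iwind f (zr a) + f a" using jump[OF a] by simp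
      then show ?thesis using True by (simp add: h2_def algebra_simps)
    next
      case False
      then show ?thesis using split(3,4) by (auto simp: d_def)
    qed
    ultimately show ?thesis by (subst circulation_cong) (assumption | blast)+
  qed
qed

text \<open>Connectedness of the dual graph: without a jump across \<open>e\<close> the function
  stays invariant when \<open>e\<close> is erased, and once all arcs are gone the plane is a single
  face.\<close>

lemma coboundary_zero_constant:
  assumes sp: "side_points zl zr" and B: "B \<subseteq> A" and h: "face_invariant B h"
    and zero: "\<And>a. a \<in> B \<Longrightarrow> h (zl a) = h (zr a)" and z: "z \<notin> net A" "z' \<notin> net A"
  shows "h z = h z'"
  using finite_subset[OF B finite_A] B h zero
proof (induction B rule: finite_induct)
  case empty
  have "sim {} z z'" unfolding sim_def net_def connected_component_def by (intro exI[of _ UNIV]) auto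
  then show ?case using empty z by (auto simp: face_invariant_def)
next
  case (insert e B)
  have e: "e \<in> A" and B: "B \<subseteq> A" using insert.prems by auto
  have zs: "zl e \<notin> net A" "zr e \<notin> net A" using sp e by (auto simp: side_points_def)
  have inv: "h z = h z'" if "z \<notin> net A" "z' \<notin> net A" "sim (insert e B) z z'" for z z'
    using insert.prems(2) that by (auto simp: face_invariant_def)
  have "face_invariant B h"
  proof (cases rule: add_arc_cases[OF e B insert.hyps(2) sp, case_names bridge split])
    case bridge
    then show ?thesis using inv by (auto simp: face_invariant_def)
  next
    case (split f)
    have lr: "h (zl e) = h (zr e)" using insert.prems(3) by blast
    have "h z = h z'" if z: "z \<notin> net A" "z' \<notin> net A" "sim B z z'" for z z'
    proof (cases "sim (insert e B) z z'")
      case False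
      then have "sim B z (zl e)" using split(6) z by blast
      moreover from this have "sim B z' (zl e)" using z(3) sim_sym sim_trans by blast
      ultimately have "h z = h (zl e)" "h z' = h (zl e)"
        using split(7) inv z zs lr by metis+
      then show ?thesis by simp
    qed (use inv z in blast)
    then show ?thesis by (auto simp: face_invariant_def)
  qed
  then show ?case using insert.IH B insert.prems(3) by blast
qed

section \<open>Components of the graph and Euler's formula\<close>

definition comps :: "'b set \<Rightarrow> complex set set" where
  "comps B = (\<lambda>x. (adj B)\<^sup>* `` {x}) ` V"

lemma comps_insert: "comps (insert e B) = (\<lambda>K. (adj (insert e B))\<^sup>* `` K) ` comps B"
proof -
  have "(adj (insert e B))\<^sup>* `` {x} = (adj (insert e B))\<^sup>* `` ((adj B)\<^sup>* `` {x})" for x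
  proof -
    have "(adj B)\<^sup>* \<subseteq> (adj (insert e B))\<^sup>*" by (intro rtrancl_mono adj_mono) auto
    then show ?thesis by (auto intro: rtrancl_trans)
  qed
  then show ?thesis unfolding comps_def image_image by simp
qed

lemma card_comps_insert_le: "card (comps (insert e B)) \<le> card (comps B)"
  unfolding comps_insert by (rule card_image_le) (simp add: comps_def finite_V)

lemma card_comps_insert_bridge:
  assumes e: "e \<in> A" and nc: "(src e, tgt e) \<notin> (adj B)\<^sup>*"
  shows "card (comps (insert e B)) < card (comps B)"
proof -
  let ?R = "(adj (insert e B))\<^sup>*"
  let ?u = "(adj B)\<^sup>* `` {src e}" and ?v = "(adj B)\<^sup>* `` {tgt e}"
  have V: "src e \<in> V" "tgt e \<in> V" using ends_in_V[OF e] by auto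
  have fin: "finite (comps B)" by (simp add: comps_def finite_V)
  have in_comps: "?u \<in> comps B" "?v \<in> comps B" using V by (auto simp: comps_def)
  have "?u \<noteq> ?v" using nc by auto
  moreover have "?R `` ?u = ?R `` ?v"
  proof -
    have sub: "(adj B)\<^sup>* \<subseteq> ?R" by (intro rtrancl_mono adj_mono) auto
    have R: "(src e, tgt e) \<in> ?R" "(tgt e, src e) \<in> ?R" by (auto simp: adj_def)
    have "?R `` ?u = ?R `` {src e}" "?R `` ?v = ?R `` {tgt e}" using sub by (auto intro: rtrancl_trans)
    moreover have "?R `` {src e} = ?R `` {tgt e}" using R by (auto intro: rtrancl_trans)
    ultimately show ?thesis by simp
  qed
  ultimately have "comps (insert e B) = (\<lambda>K. ?R `` K) ` (comps B - {?v})"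
    unfolding comps_insert using image_Diff_collision[OF in_comps(1), of ?v "\<lambda>K. ?R `` K"] by simp
  then have "card (comps (insert e B)) \<le> card (comps B - {?v})" using fin by (simp add: card_image_le)
  also have "\<dots> < card (comps B)" using fin in_comps by (intro psubset_card_mono) auto
  finally show ?thesis .
qed

text \<open>One direction of Euler's formula, with faces represented by the points of
  \<open>Y\<close>: each added arc either merges two components or yields an additional
  face.\<close>

lemma many_faces:
  assumes sp: "side_points zl zr" and B: "B \<subseteq> A"
  shows "\<exists>Y. finite Y \<and> Y \<inter> net A = {} \<and> (\<forall>y\<in>Y. \<forall>y'\<in>Y. sim B y y' \<longrightarrow> y = y') \<and>
    card B + 1 + card (comps B) \<le> card Y + card V"
  using finite_subset[OF B finite_A] B
proof (induction B rule: finite_induct)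
  case empty
  obtain z0 where "z0 \<notin> net A" using net_complement_nonempty by blast
  moreover have "card (comps {}) \<le> card V" unfolding comps_def by (rule card_image_le[OF finite_V])
  ultimately show ?case by (intro exI[of _ "{z0}"]) auto
next
  case (insert e B)
  have e: "e \<in> A" and B: "B \<subseteq> A" using insert.prems by auto
  have zs: "zl e \<notin> net A" "zr e \<notin> net A" using sp e by (auto simp: side_points_def)
  obtain Y where Y: "finite Y" "Y \<inter> net A = {}" "\<And>y y'. y \<in> Y \<Longrightarrow> y' \<in> Y \<Longrightarrow> sim B y y' \<Longrightarrow> y = y'"
    "card B + 1 + card (comps B) \<le> card Y + card V" using insert.IH[OF B] by blast
  have anti: "sim B z z'" if "sim (insert e B) z z'" for z z' using sim_antimono[OF that] by blast
  show ?case
  proof (cases rule: add_arc_cases[OF e B insert.hyps(2) sp, case_names bridge split])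
    case bridge
    have "\<forall>y\<in>Y. \<forall>y'\<in>Y. sim (insert e B) y y' \<longrightarrow> y = y'" using Y(3) anti by blast
    moreover have "card (insert e B) + 1 + card (comps (insert e B)) \<le> card Y + card V"
      using card_comps_insert_bridge[OF e bridge(1)] Y(4) insert.hyps by simp
    ultimately show ?thesis using Y(1,2) by blast
  next
    case (split f)
    \<comment> \<open>At most one chosen point lies in the face that \<open>e\<close> splits. It
      gives way to one point on each side of \<open>e\<close>, so the count grows by at least
      1.\<close>
    define N where "N = {y\<in>Y. sim B y (zl e)}"
    define Y' where "Y' = insert (zl e) (insert (zr e) (Y - N))"
    have "y = y'" if "y \<in> N" "y' \<in> N" for y y'
    proof -
      have "sim B y y'" using that sim_trans sim_sym unfolding N_def by blast
      then show ?thesis using Y(3) that by (auto simp: N_def)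
    qed
    then have "card N \<le> 1" using Y(1) by (auto simp: card_le_Suc0_iff_eq N_def)
    moreover have "card (Y - N) = card Y - card N" using Y(1) by (intro card_Diff_subset) (auto simp: N_def)
    moreover have "card N \<le> card Y" using Y(1) by (intro card_mono) (auto simp: N_def)
    ultimately have cY: "card Y \<le> card (Y - N) + 1" by linarith
    have not: "\<not> sim (insert e B) (zl e) (zr e)"
    proof
      assume "sim (insert e B) (zl e) (zr e)"
      then have "iwind f (zl e) = iwind f (zr e)" using iwind_sim[OF split(2,4)] by blast
      then show False using iwind_sides[OF sp split(2) e] split(3) by simp
    qed
    then have ne: "zl e \<noteq> zr e" using sim_refl[OF zs(1), of "insert e B"] e B by auto
    have far: "\<not> sim B y (zl e)" "\<not> sim B y (zr e)" "\<not> sim B (zl e) y" "\<not> sim B (zr e) y" if "y \<in> Y - N" for y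
    proof -
      show 1: "\<not> sim B y (zl e)" using that by (auto simp: N_def)
      then show 2: "\<not> sim B y (zr e)" using split(5) sim_trans sim_sym by blast
      show "\<not> sim B (zl e) y" "\<not> sim B (zr e) y" using 1 2 sim_sym by blast+
    qed
    have refl: "sim B (zl e) (zl e)" "sim B (zr e) (zr e)" using sim_refl zs B by blast+
    have "card Y' = card (Y - N) + 2"
      unfolding Y'_def using Y(1) ne far refl by (subst card_insert_disjoint; auto simp: card_insert_disjoint)+
    then have "card (insert e B) + 1 + card (comps (insert e B)) \<le> card Y' + card V"
      using card_comps_insert_le[of e B] Y(4) cY insert.hyps by simp
    moreover have "y = y'" if "y \<in> Y'" "y' \<in> Y'" "sim (insert e B) y y'" for y y'
      using that(1,2) unfolding Y'_def
      by (elim insertE; use that(3) not far anti Y(3) sim_sym in blast)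
    moreover have "finite Y'" "Y' \<inter> net A = {}" using Y zs by (auto simp: Y'_def)
    ultimately show ?thesis by blast
  qed
qed

text \<open>This is all that is used of the topology afterwards. Coboundaries of integer face
  functions are exactly the circulations on \<open>A\<close>, only constants have coboundary zero,
  and the last clause is Euler's inequality with at least one component.\<close>

theorem planar_dual:
  "\<exists>(F :: complex set set) l r. finite F \<and> (\<forall>a\<in>A. l a \<in> F \<and> r a \<in> F) \<and>
    (\<forall>h. circ (\<lambda>a. h (l a) - h (r a))) \<and>
    (\<forall>f. circ f \<longrightarrow> (\<exists>h. \<forall>a\<in>A. f a = h (l a) - h (r a))) \<and>
    (\<forall>h :: complex set \<Rightarrow> int. (\<forall>a\<in>A. h (l a) = h (r a)) \<longrightarrow> (\<forall>x\<in>F. \<forall>y\<in>F. h x = h y)) \<and>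
    (V \<noteq> {} \<longrightarrow> card A + 2 \<le> card F + card V)"
proof -
  obtain zl zr where sp: "side_points zl zr" using side_points_exist by blast
  define face where "face = connected_component_set (- net A)"
  define F where "F = face ` (- net A)"
  define l where "l a = face (zl a)" for a
  define r where "r a = face (zr a)" for a
  have zs: "zl a \<notin> net A" "zr a \<notin> net A" if "a \<in> A" for a using sp that by (auto simp: side_points_def)
  have lr: "l a \<in> F" "r a \<in> F" if "a \<in> A" for a using zs[OF that] by (auto simp: l_def r_def F_def)
  have face_eq: "face z = face z' \<longleftrightarrow> sim A z z'" if "z \<notin> net A" "z' \<notin> net A" for z z'
    using that unfolding face_def sim_def by (auto simp: connected_component_eq_eq)
  have inv: "face_invariant A (\<lambda>z. h (face z))" for h
    unfolding face_invariant_def using face_eq by metis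
  have const: "h x = h y" if "\<forall>a\<in>A. h (l a) = h (r a)" "x \<in> F" "y \<in> F" for h :: "complex set \<Rightarrow> int" and x y
  proof -
    obtain z z' where z: "z \<notin> net A" "z' \<notin> net A" "x = face z" "y = face z'"
      using \<open>x \<in> F\<close> \<open>y \<in> F\<close> unfolding F_def by blast
    have "h (face z) = h (face z')"
      by (rule coboundary_zero_constant[OF sp subset_refl inv _ z(1,2)]) (use that(1) in \<open>simp add: l_def r_def\<close>)
    then show ?thesis using z by simp
  qed
  \<comment> \<open>The indicator of a face that is on neither side of any arc has no jump, hence is
    constant, and that face is the only one.\<close>
  have fin: "finite F"
  proof (cases "F \<subseteq> l ` A \<union> r ` A")
    case True
    then show ?thesis by (rule finite_subset) (simp add: finite_A)
  next
    case False
    then obtain x where x: "x \<in> F" "x \<notin> l ` A \<union> r ` A" by blast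
    have "y = x" if "y \<in> F" for y
    proof -
      have "(of_bool (x = x) :: int) = of_bool (y = x)"
        by (rule const[of "\<lambda>y. of_bool (y = x)"]) (use x that in auto)
      then show ?thesis by (simp split: if_splits)
    qed
    then have "F \<subseteq> {x}" by blast
    then show ?thesis by (rule finite_subset) simp
  qed
  have cob: "circ (\<lambda>a. h (l a) - h (r a))" for h
  proof -
    have "circ (\<lambda>a. if a \<in> A then h (face (zl a)) - h (face (zr a)) else 0)"
      by (rule coboundary_circulation[OF sp subset_refl inv])
    then show ?thesis
      by (subst circulation_cong[where g = "\<lambda>a. if a \<in> A then h (face (zl a)) - h (face (zr a)) else 0"])
        (auto simp: l_def r_def)
  qed
  have pot: "\<exists>h. \<forall>a\<in>A. f a = h (l a) - h (r a)" if f: "circ f" for f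
  proof -
    \<comment> \<open>Being a circulation says nothing about values outside \<open>A\<close>, while
      \<open>iwind_sim\<close> needs them to be 0.\<close>
    define g where "g a = (if a \<in> A then f a else 0)" for a
    have g: "circ g" using f by (subst circulation_cong[where g = f]) (auto simp: g_def)
    define h where "h X = iwind g (SOME z. z \<notin> net A \<and> face z = X)" for X
    have h: "h (face z) = iwind g z" if z: "z \<notin> net A" for z
    proof -
      let ?z = "SOME y. y \<notin> net A \<and> face y = face z"
      have "?z \<notin> net A \<and> face ?z = face z" by (rule someI[of _ z]) (use z in simp)
      then have "sim A ?z z" using face_eq z by blast
      then show ?thesis unfolding h_def by (intro iwind_sim[OF g]) (auto simp: g_def)
    qed
    have "f a = h (l a) - h (r a)" if "a \<in> A" for a
      using iwind_sides[OF sp g that] h zs[OF that] that by (simp add: l_def r_def g_def)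
    then show ?thesis by blast
  qed
  have "card A + 2 \<le> card F + card V" if "V \<noteq> {}"
  proof -
    obtain Y where Y: "finite Y" "Y \<inter> net A = {}" "\<forall>y\<in>Y. \<forall>y'\<in>Y. sim A y y' \<longrightarrow> y = y'"
      "card A + 1 + card (comps A) \<le> card Y + card V" using many_faces[OF sp subset_refl] by blast
    have "inj_on face Y" using Y(2,3) face_eq by (intro inj_onI) blast
    then have "card Y \<le> card F"
      by (rule card_inj_on_le[OF _ _ fin]) (use Y(2) in \<open>auto simp: F_def\<close>)
    moreover have "card (comps A) > 0" using that finite_V by (simp add: comps_def card_gt_0_iff)
    ultimately show ?thesis using Y(4) by linarith
  qed
  then show ?thesis using fin lr const cob pot
    by (intro exI[of _ F] exI[of _ l] exI[of _ r]) blast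
qed

end

section \<open>Oriented planar graphs\<close>

lemma circulation_inj_iff:
  assumes "inj_on p V" "\<And>a. a \<in> A \<Longrightarrow> s a \<in> V \<and> t a \<in> V"
  shows "circulation A (\<lambda>a. p (s a)) (\<lambda>a. p (t a)) f = circulation A s t f"
proof -
  have eq: "(\<Sum>a\<in>A. f a * (of_bool (p (s a) = p v) - of_bool (p (t a) = p v)))
      = (\<Sum>a\<in>A. f a * (of_bool (s a = v) - of_bool (t a = v)))" if "v \<in> V" for v
    by (rule sum.cong[OF refl]) (use assms that in \<open>simp add: inj_on_eq_iff\<close>)
  have off1: "(\<Sum>a\<in>A. f a * (of_bool (s a = v) - of_bool (t a = v))) = 0" if "v \<notin> V" for v
    by (rule sum.neutral) (use assms that in auto)
  have off2: "(\<Sum>a\<in>A. f a * (of_bool (p (s a) = w) - of_bool (p (t a) = w))) = 0" if "w \<notin> p ` V" for w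
    by (rule sum.neutral) (use assms that in auto)
  show ?thesis unfolding circulation_def
  proof (intro iffI allI)
    fix v assume "\<forall>w. (\<Sum>a\<in>A. f a * (of_bool (p (s a) = w) - of_bool (p (t a) = w))) = 0"
    then show "(\<Sum>a\<in>A. f a * (of_bool (s a = v) - of_bool (t a = v))) = 0"
      using eq off1 by (cases "v \<in> V") auto
  next
    fix w assume "\<forall>v. (\<Sum>a\<in>A. f a * (of_bool (s a = v) - of_bool (t a = v))) = 0"
    then show "(\<Sum>a\<in>A. f a * (of_bool (p (s a) = w) - of_bool (p (t a) = w))) = 0"
      using eq off2 by (cases "w \<in> p ` V") auto
  qed
qed

text \<open>Deleting a vertex on at least two arcs lowers \<open>2 * card V\<close> by 2 and
  \<open>card J\<close> by at least 2. Once no such vertex is left, the arcs form a matching: taking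
  an isolated vertex costs 2, and taking one end of an arc costs 4 minus the 1 regained from the
  arc, so neither exceeds the 3 gained.\<close>

lemma large_independent_set:
  assumes "finite V" "finite J" "\<And>a. a \<in> J \<Longrightarrow> t a \<in> V \<and> h a \<in> V \<and> t a \<noteq> h a"
  shows "\<exists>S\<subseteq>V. (\<forall>a\<in>J. \<not> (t a \<in> S \<and> h a \<in> S)) \<and> 2 * card V \<le> card J + 3 * card S"
  using assms
proof (induction "card V" arbitrary: V J rule: less_induct)
  case less
  define inc where "inc v = {a\<in>J. t a = v \<or> h a = v}" for v
  have fin_inc: "finite (inc v)" for v using less.prems by (simp add: inc_def)
  show ?case
  proof (cases "V = {}")
    case False
    show ?thesis
    proof (cases "\<exists>v\<in>V. 2 \<le> card (inc v)")
      case True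
      then obtain v where v: "v \<in> V" "2 \<le> card (inc v)" by blast
      have V: "card V = Suc (card (V - {v}))" using v less.prems(1) by (intro card.remove) auto
      have J: "card (J - inc v) + card (inc v) = card J"
      proof -
        have "inc v \<subseteq> J" by (auto simp: inc_def)
        then show ?thesis using card_Diff_subset[OF fin_inc] card_mono[OF less.prems(2)] by fastforce
      qed
      have "\<exists>S\<subseteq>V - {v}. (\<forall>a\<in>J - inc v. \<not> (t a \<in> S \<and> h a \<in> S)) \<and>
          2 * card (V - {v}) \<le> card (J - inc v) + 3 * card S"
        by (rule less.hyps) (use less.prems V in \<open>auto simp: inc_def\<close>)
      then obtain S where S: "S \<subseteq> V - {v}" "\<forall>a\<in>J - inc v. \<not> (t a \<in> S \<and> h a \<in> S)"
          "2 * card (V - {v}) \<le> card (J - inc v) + 3 * card S" by blast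
      have "\<not> (t a \<in> S \<and> h a \<in> S)" if "a \<in> J" for a
        using S(1,2) that by (cases "a \<in> inc v") (auto simp: inc_def)
      moreover have "2 * card V \<le> card J + 3 * card S" using S(3) V J v(2) by linarith
      ultimately show ?thesis using S(1) by blast
    next
      case small: False
      obtain v where v: "v \<in> V" using False by blast
      have V: "card V = Suc (card (V - {v}))" using v less.prems(1) by (intro card.remove) auto
      show ?thesis
      proof (cases "inc v = {}")
        case True
        have "\<exists>S\<subseteq>V - {v}. (\<forall>a\<in>J. \<not> (t a \<in> S \<and> h a \<in> S)) \<and> 2 * card (V - {v}) \<le> card J + 3 * card S"
          by (rule less.hyps) (use less.prems V True in \<open>auto simp: inc_def\<close>)
        then obtain S where S: "S \<subseteq> V - {v}" "\<forall>a\<in>J. \<not> (t a \<in> S \<and> h a \<in> S)"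
            "2 * card (V - {v}) \<le> card J + 3 * card S" by blast
        have "card (insert v S) = Suc (card S)"
          using S(1) less.prems(1) finite_subset by (subst card_insert_disjoint) (auto dest: finite_subset)
        then have "2 * card V \<le> card J + 3 * card (insert v S)" using S(3) V by linarith
        moreover have "\<forall>a\<in>J. \<not> (t a \<in> insert v S \<and> h a \<in> insert v S)" using S(2) True by (auto simp: inc_def)
        ultimately show ?thesis using S(1) v by (intro exI[of _ "insert v S"]) auto
      next
        case False
        then obtain a where a: "a \<in> inc v" by blast
        define u where "u = (if t a = v then h a else t a)"
        have aJ: "a \<in> J" and u: "u \<in> V" "u \<noteq> v" "{t a, h a} = {v, u}" "a \<in> inc u"
          using a less.prems(3)[of a] by (auto simp: inc_def u_def)
        have only: "b = a" if "b \<in> inc x" "a \<in> inc x" "x \<in> V" for b x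
        proof -
          have "card (inc x) \<le> 1" using small that(3) by force
          then show ?thesis using that fin_inc[of x] by (auto simp: card_le_Suc0_iff_eq)
        qed
        have V2: "card V = Suc (Suc (card (V - {v, u})))"
        proof -
          have "V - {v} - {u} = V - {v, u}" by blast
          moreover have "card (V - {v}) = Suc (card (V - {v} - {u}))"
            using u less.prems(1) by (intro card.remove) auto
          ultimately show ?thesis using V by simp
        qed
        have J: "card J = Suc (card (J - {a}))" using aJ less.prems(2) by (intro card.remove) auto
        have off: "t b \<notin> {v, u} \<and> h b \<notin> {v, u}" if "b \<in> J - {a}" for b
          using only[of b v] only[of b u] a u(1,4) v that by (auto simp: inc_def)
        have "\<exists>S\<subseteq>V - {v, u}. (\<forall>b\<in>J - {a}. \<not> (t b \<in> S \<and> h b \<in> S)) \<and>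
            2 * card (V - {v, u}) \<le> card (J - {a}) + 3 * card S"
          by (rule less.hyps) (use less.prems V2 off in auto)
        then obtain S where S: "S \<subseteq> V - {v, u}" "\<forall>b\<in>J - {a}. \<not> (t b \<in> S \<and> h b \<in> S)"
            "2 * card (V - {v, u}) \<le> card (J - {a}) + 3 * card S" by blast
        have "card (insert v S) = Suc (card S)"
          using S(1) less.prems(1) finite_subset by (subst card_insert_disjoint) (auto dest: finite_subset)
        then have "2 * card V \<le> card J + 3 * card (insert v S)" using S(3) V2 J by linarith
        moreover have "\<not> (t b \<in> insert v S \<and> h b \<in> insert v S)" if "b \<in> J" for b
        proof (cases "b = a")
          case True
          have "u \<notin> insert v S" using S(1) u(2) by auto
          moreover have "u \<in> {t a, h a}" using u(3) by simp
          ultimately show ?thesis using True by auto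
        next
          case False
          then show ?thesis using S(2) off that by auto
        qed
        ultimately show ?thesis using S(1) v by (intro exI[of _ "insert v S"]) auto
      qed
    qed
  qed auto
qed

section \<open>Duality applied to planar oriented graphs\<close>

context oriented_graph begin

abbreviation circ :: "('b \<Rightarrow> int) \<Rightarrow> bool" where
  "circ \<equiv> circulation (arcs G) (tail G) (head G)"

text \<open>Each curve is traversed from tail to head, reversed where necessary. As no two arcs join
  the same pair of vertices, different arcs belong to different edges of the drawing.\<close>

lemma drawing_dual:
  assumes "planar_digraph G"
  shows "\<exists>(F :: complex set set) l r. finite F \<and> (\<forall>a\<in>arcs G. l a \<in> F \<and> r a \<in> F) \<and>
    (\<forall>h. circ (\<lambda>a. h (l a) - h (r a))) \<and>
    (\<forall>f. circ f \<longrightarrow> (\<exists>h. \<forall>a\<in>arcs G. f a = h (l a) - h (r a))) \<and>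
    (\<forall>h :: complex set \<Rightarrow> int. (\<forall>a\<in>arcs G. h (l a) = h (r a)) \<longrightarrow> (\<forall>x\<in>F. \<forall>y\<in>F. h x = h y)) \<and>
    (verts G \<noteq> {} \<longrightarrow> card (arcs G) + 2 \<le> card F + card (verts G))"
proof -
  obtain pos \<gamma> where d: "plane_drawing (verts G) (underlying_edges G) pos \<gamma>"
    using assms by (auto simp: planar_digraph_def)
  define ends where "ends a = {tail G a, head G a}" for a
  define c where "c a = (if pathstart (\<gamma> (ends a)) = pos (tail G a) then \<gamma> (ends a)
    else reversepath (\<gamma> (ends a)))" for a
  have inj: "inj_on pos (verts G)" using d by (simp add: plane_drawing_def)
  have E: "ends a \<in> underlying_edges G" if "a \<in> arcs G" for a
    using that by (auto simp: underlying_edges_def ends_def)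
  have arc: "Path_Connected.arc (\<gamma> (ends a))" "{pathstart (\<gamma> (ends a)), pathfinish (\<gamma> (ends a))} = {pos (tail G a), pos (head G a)}"
    "\<gamma> (ends a) ` {0<..<1} \<inter> pos ` verts G = {}" if "a \<in> arcs G" for a
    using d E[OF that] by (auto simp: plane_drawing_def ends_def)
  have c_arc: "Path_Connected.arc (c a)" if "a \<in> arcs G" for a
    using arc(1)[OF that] by (simp add: c_def arc_reversepath)
  have c_ends: "pathstart (c a) = pos (tail G a)" "pathfinish (c a) = pos (head G a)" if "a \<in> arcs G" for a
    using arc(2)[OF that] by (auto simp: c_def doubleton_eq_iff)
  have rev: "reversepath p ` {0<..<1} = p ` {0<..<1}" for p :: "real \<Rightarrow> complex"
  proof -
    have "(\<lambda>x. 1 - x) ` {0<..<1} = {0<..<1::real}"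
      by (auto intro: image_eqI[where x = "1 - _"])
    then show ?thesis unfolding reversepath_def by (metis image_image)
  qed
  have c_int: "c a ` {0<..<1} = \<gamma> (ends a) ` {0<..<1}" for a by (simp add: c_def rev)
  have c_im: "path_image (c a) = path_image (\<gamma> (ends a))" for a by (simp add: c_def)
  interpret P: plane_digraph "pos ` verts G" "arcs G" c
  proof
    fix a b assume ab: "a \<in> arcs G" "b \<in> arcs G" "a \<noteq> b"
    then have "ends a \<noteq> ends b" using at_most_one_arc[of a b] by (auto simp: ends_def)
    then show "c a ` {0<..<1} \<inter> path_image (c b) = {}"
      unfolding c_int c_im using d E ab by (simp add: plane_drawing_def)
  qed (use arc c_arc c_ends c_int in auto)
  have "P.circ f = circulation (arcs G) (\<lambda>a. pos (tail G a)) (\<lambda>a. pos (head G a)) f" for f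
    unfolding circulation_def using c_ends by (simp cong: sum.cong)
  then have eq: "P.circ f = circ f" for f
    using circulation_inj_iff[OF inj, of "arcs G" "tail G" "head G" f] by simp
  have "card (pos ` verts G) = card (verts G)" using inj by (rule card_image)
  then show ?thesis using P.planar_dual unfolding eq by simp
qed

text \<open>Conservation forces a further arc of the support at either end of \<open>a\<close>. The
  same arc cannot serve both ends, since it would join the same two vertices as
  \<open>a\<close>.\<close>

lemma circulation_support_ge_3:
  assumes f: "circ f" and a: "a \<in> arcs G" "f a \<noteq> 0"
  shows "3 \<le> card {b\<in>arcs G. f b \<noteq> 0}"
proof -
  have other: "\<exists>b\<in>arcs G. b \<noteq> a \<and> f b \<noteq> 0 \<and> (tail G b = v \<or> head G b = v)"
    if v: "tail G a = v \<or> head G a = v" for v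
  proof (rule ccontr)
    assume n: "\<not> ?thesis"
    have "(\<Sum>b\<in>arcs G. f b * (of_bool (tail G b = v) - of_bool (head G b = v)))
        = f a * (of_bool (tail G a = v) - of_bool (head G a = v))
          + (\<Sum>b\<in>arcs G - {a}. f b * (of_bool (tail G b = v) - of_bool (head G b = v)))"
      using a by (intro sum.remove) auto
    also have "(\<Sum>b\<in>arcs G - {a}. f b * (of_bool (tail G b = v) - of_bool (head G b = v))) = 0"
      using n by (intro sum.neutral) auto
    finally have "f a * (of_bool (tail G a = v) - of_bool (head G a = v)) = 0"
      using f by (simp add: circulation_def)
    then show False using a v no_loops[OF a(1)] by auto
  qed
  obtain b where b: "b \<in> arcs G" "b \<noteq> a" "f b \<noteq> 0" "tail G b = tail G a \<or> head G b = tail G a"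
    using other by blast
  obtain d where d: "d \<in> arcs G" "d \<noteq> a" "f d \<noteq> 0" "tail G d = head G a \<or> head G d = head G a"
    using other by blast
  have "b \<noteq> d"
  proof
    assume "b = d"
    then have "{tail G b, head G b} = {tail G a, head G a}"
      using b(4) d(4) no_loops[OF a(1)] by auto
    then show False using at_most_one_arc[OF b(1) a(1)] b(2) by blast
  qed
  then have "card {a, b, d} = 3" using b(2) d(2) by auto
  moreover have "{a, b, d} \<subseteq> {b\<in>arcs G. f b \<noteq> 0}" using a b d by auto
  ultimately show ?thesis using card_mono[of "{b\<in>arcs G. f b \<noteq> 0}" "{a, b, d}"] by simp
qed

text \<open>If there are at least two faces, the indicator of each has a nonzero coboundary, so at
  least three arcs have that face on exactly one side. Each arc is counted for at most two faces,
  whence \<open>3 * card F \<le> 2 * card (arcs G)\<close>, and Euler's inequality gives the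
  rest.\<close>

lemma planar_arcs_le:
  assumes "planar_digraph G"
  shows "card (arcs G) \<le> 3 * card (verts G)"
proof (cases "verts G = {}")
  case True
  then have "arcs G = {}" using tail_in_verts by blast
  then show ?thesis by simp
next
  case False
  obtain F :: "complex set set" and l r where dual: "finite F" "\<forall>a\<in>arcs G. l a \<in> F \<and> r a \<in> F"
    "\<forall>h. circ (\<lambda>a. h (l a) - h (r a))"
    "\<forall>f. circ f \<longrightarrow> (\<exists>h. \<forall>a\<in>arcs G. f a = h (l a) - h (r a))"
    "\<forall>h :: complex set \<Rightarrow> int. (\<forall>a\<in>arcs G. h (l a) = h (r a)) \<longrightarrow> (\<forall>x\<in>F. \<forall>y\<in>F. h x = h y)"
    "verts G \<noteq> {} \<longrightarrow> card (arcs G) + 2 \<le> card F + card (verts G)"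
    using drawing_dual[OF assms] by (elim exE conjE) (rule that)
  note F = dual(1) bspec[OF dual(2)] spec[OF dual(3)] mp[OF spec[OF dual(5)]] mp[OF dual(6) False]
  show ?thesis
  proof (cases "card F \<le> 1")
    case True
    then show ?thesis using F(5) by linarith
  next
    case False
    have three: "3 \<le> card {a\<in>arcs G. (l a = x) \<noteq> (r a = x)}" if x: "x \<in> F" for x
    proof -
      define h where "h y = (of_bool (y = x) :: int)" for y
      have "F \<noteq> {x}" using False by auto
      then obtain y where "y \<in> F" "y \<noteq> x" using x by blast
      then have "\<not> (\<forall>u\<in>F. \<forall>w\<in>F. h u = h w)" using x by (auto simp: h_def)
      then obtain a where "a \<in> arcs G" "h (l a) \<noteq> h (r a)" using F(4)[of h] by blast
      then have "3 \<le> card {b\<in>arcs G. h (l b) - h (r b) \<noteq> 0}"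
        using circulation_support_ge_3[OF F(3)[of h]] by simp
      moreover have "{b\<in>arcs G. h (l b) - h (r b) \<noteq> 0} = {a\<in>arcs G. (l a = x) \<noteq> (r a = x)}"
        by (auto simp: h_def)
      ultimately show ?thesis by simp
    qed
    have "3 * card F = (\<Sum>x\<in>F. 3)" by simp
    also have "\<dots> \<le> (\<Sum>x\<in>F. card {a\<in>arcs G. (l a = x) \<noteq> (r a = x)})" by (intro sum_mono three)
    also have "\<dots> = (\<Sum>a\<in>arcs G. card {x\<in>F. (l a = x) \<noteq> (r a = x)})"
      by (rule sum_multicount_gen) (use F(1) in auto)
    also have "\<dots> \<le> (\<Sum>a\<in>arcs G. 2)"
    proof (rule sum_mono)
      fix a assume "a \<in> arcs G"
      have "card {x\<in>F. (l a = x) \<noteq> (r a = x)} \<le> card {l a, r a}" by (intro card_mono) auto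
      also have "\<dots> \<le> 2" by (simp add: card_insert_if)
      finally show "card {x\<in>F. (l a = x) \<noteq> (r a = x)} \<le> 2" .
    qed
    finally show ?thesis using F(5) by simp
  qed
qed

text \<open>What enters the head of an arc of the support must leave it again along the support. So
  a walk in the support never gets stuck, and by finiteness it closes up.\<close>

lemma nonneg_circulation_cycle:
  assumes f: "circ f" and nonneg: "\<And>a. a \<in> arcs G \<Longrightarrow> f a \<ge> 0" and a: "a \<in> arcs G" "f a \<noteq> 0"
  shows "\<exists>p. cycle p \<and> set p \<subseteq> {b\<in>arcs G. f b \<noteq> 0}"
proof -
  define S where "S = {b\<in>arcs G. f b \<noteq> 0}"
  define H where "H = G\<lparr>arcs := S\<rparr>"
  have SG: "S \<subseteq> arcs G" by (auto simp: S_def)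
  interpret H: fin_digraph H
    by unfold_locales (use SG finite_subset[OF SG] in \<open>auto simp: H_def\<close>)
  have sub: "subgraph H G"
    using SG by (intro subgraphI) (auto simp: H_def compatible_def wf_digraph H.wf_digraph[unfolded H_def])
  have "\<exists>b\<in>S. tail G b = head G d" if d: "d \<in> S" for d
  proof (rule ccontr)
    assume n: "\<not> ?thesis"
    have "(\<Sum>b\<in>arcs G. f b * (of_bool (tail G b = head G d) - of_bool (head G b = head G d)))
      \<le> (\<Sum>b\<in>arcs G. if b = d then - f d else 0)"
    proof (rule sum_mono)
      fix b assume b: "b \<in> arcs G"
      show "f b * (of_bool (tail G b = head G d) - of_bool (head G b = head G d)) \<le> (if b = d then - f d else 0)"
        using n b nonneg[OF b] no_loops[OF b] by (cases "f b = 0") (auto simp: S_def)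
    qed
    also have "\<dots> = - f d" using d SG by (subst sum.delta) auto
    finally show False using f d nonneg[of d] by (simp add: circulation_def S_def)
  qed
  then have step: "\<exists>w. (u, w) \<in> arcs_ends H \<and> w \<in> Range (arcs_ends H)" if "u \<in> Range (arcs_ends H)" for u
    using that unfolding arcs_ends_def arc_to_ends_def H_def by force
  have "\<not> acyclic (arcs_ends H)"
  proof
    assume "acyclic (arcs_ends H)"
    moreover have "finite (arcs_ends H)" by (simp add: arcs_ends_def)
    ultimately have "wf ((arcs_ends H)\<inverse>)" by (rule finite_acyclic_wf_converse[rotated])
    moreover have "head G a \<in> Range (arcs_ends H)"
      using a by (force simp: arcs_ends_def arc_to_ends_def H_def S_def)
    ultimately obtain z where "z \<in> Range (arcs_ends H)"
      "\<And>y. (y, z) \<in> (arcs_ends H)\<inverse> \<Longrightarrow> y \<notin> Range (arcs_ends H)"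
      by (rule wfE_min) blast
    then show False using step by blast
  qed
  then obtain u where "u \<rightarrow>\<^sup>+\<^bsub>H\<^esub> u" by (auto simp: acyclic_def)
  then obtain p where "H.awalk u p u" "p \<noteq> []" using H.reachable1_awalk by blast
  then have "H.closed_w p" by (auto simp: H.closed_w_def)
  then obtain q where q: "H.cycle q" using H.closed_w_imp_cycle by blast
  then have "cycle q" using subgraph_cycle[OF sub] by blast
  moreover have "set q \<subseteq> arcs H" using q unfolding H.cycle_def H.awalk_def by blast
  then have "set q \<subseteq> S" by (simp add: H_def)
  ultimately show ?thesis unfolding S_def by blast
qed

lemma cycle_circulation:
  assumes "cycle p"
  shows "circ (\<lambda>a. of_bool (a \<in> set p))"
  unfolding circulation_def
proof
  fix v
  define k where "k a = (of_bool (tail G a = v) - of_bool (head G a = v) :: int)" for a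
  obtain u where u: "awalk u p u" "distinct p" using assms by (auto simp: cycle_conv)
  have cas: "cas x q y \<Longrightarrow> sum_list (map k q) = of_bool (x = v) - of_bool (y = v)" for x q y
    by (induction q arbitrary: x) (auto simp: k_def)
  have "(\<Sum>a\<in>arcs G. of_bool (a \<in> set p) * k a) = (\<Sum>a\<in>set p. k a)"
    using u(1) by (intro sum.mono_neutral_cong_right) (auto simp: awalk_def)
  also have "\<dots> = sum_list (map k p)" using u(2) by (simp add: sum_list_distinct_conv_sum_set)
  also have "\<dots> = 0" using u(1) cas[of u p u] by (auto simp: awalk_def)
  finally show "(\<Sum>a\<in>arcs G. of_bool (a \<in> set p) * (of_bool (tail G a = v) - of_bool (head G a = v))) = (0::int)"
    by (simp add: k_def)
qed

text \<open>Both directions of the duality are used: the arcs of a dual directed cut contain a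
  directed cycle and so number at least \<open>g\<close>, which makes the dijoin small; and each
  directed cycle contains all arcs of some dual directed cut, which makes the dijoin meet
  it.\<close>

lemma small_feedback_arc_set:
  assumes "planar_digraph G" and g: "\<And>p. cycle p \<Longrightarrow> g \<le> length p"
  shows "\<exists>J\<subseteq>arcs G. card J * g \<le> card (arcs G) \<and> (\<forall>p. cycle p \<longrightarrow> set p \<inter> J \<noteq> {})"
proof -
  obtain F :: "complex set set" and l r where dual: "finite F" "\<forall>a\<in>arcs G. l a \<in> F \<and> r a \<in> F"
    "\<forall>h. circ (\<lambda>a. h (l a) - h (r a))"
    "\<forall>f. circ f \<longrightarrow> (\<exists>h. \<forall>a\<in>arcs G. f a = h (l a) - h (r a))"
    "\<forall>h :: complex set \<Rightarrow> int. (\<forall>a\<in>arcs G. h (l a) = h (r a)) \<longrightarrow> (\<forall>x\<in>F. \<forall>y\<in>F. h x = h y)"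
    "verts G \<noteq> {} \<longrightarrow> card (arcs G) + 2 \<le> card F + card (verts G)"
    using drawing_dual[OF assms(1)] by (elim exE conjE) (rule that)
  note F = dual(1) bspec[OF dual(2)] spec[OF dual(3)] mp[OF spec[OF dual(4)]] mp[OF spec[OF dual(5)]]
  interpret C: weakly_connected_cuts F "arcs G" l r
  proof
    fix X assume X: "X \<subseteq> F" "X \<noteq> {}" "X \<noteq> F"
    then obtain x y where xy: "x \<in> F" "y \<in> F" "x \<in> X" "y \<notin> X" by blast
    define h where "h y = (of_bool (y \<in> X) :: int)" for y
    have "h x \<noteq> h y" using xy by (simp add: h_def)
    then have "\<not> (\<forall>a\<in>arcs G. h (l a) = h (r a))" using F(5)[of h] xy by blast
    then obtain a where a: "a \<in> arcs G" "h (l a) \<noteq> h (r a)" by blast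
    from a(2) have "(l a \<in> X) \<noteq> (r a \<in> X)" by (rule contrapos_nn) (simp add: h_def)
    with a(1) show "\<exists>a\<in>arcs G. (l a \<in> X) \<noteq> (r a \<in> X)" by blast
  qed (use F in auto)
  have "g \<le> card {a\<in>arcs G. C.leaves a X}" if X: "C.dicut X" for X
  proof -
    \<comment> \<open>As no arc enters \<open>X\<close>, this circulation takes only the values 0
      and 1, and its support consists of the arcs leaving \<open>X\<close>.\<close>
    define f where "f a = (of_bool (l a \<in> X) - of_bool (r a \<in> X) :: int)" for a
    have f_eq: "f a = of_bool (C.leaves a X)" if "a \<in> arcs G" for a
      using X that by (auto simp: f_def C.leaves_def C.dicut_def)
    obtain a where a: "a \<in> arcs G" "C.leaves a X" using C.dicut_leaving_arc[OF X] by blast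
    have "\<exists>p. cycle p \<and> set p \<subseteq> {b\<in>arcs G. f b \<noteq> 0}"
      by (rule nonneg_circulation_cycle[where a = a])
        (use a f_eq F(3)[of "\<lambda>y. of_bool (y \<in> X)"] in \<open>auto simp: f_def[abs_def]\<close>)
    then obtain p where p: "cycle p" "set p \<subseteq> {b\<in>arcs G. f b \<noteq> 0}" by blast
    have "length p = card (set p)" using p(1) by (auto simp: cycle_conv distinct_card)
    also have "\<dots> \<le> card {b\<in>arcs G. f b \<noteq> 0}" using p(2) by (intro card_mono) auto
    also have "{b\<in>arcs G. f b \<noteq> 0} = {a\<in>arcs G. C.leaves a X}" using f_eq by auto
    finally show ?thesis using g[OF p(1)] by simp
  qed
  then obtain J where J: "J \<subseteq> arcs G" "card J * g \<le> card (arcs G)"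
    "\<And>X. C.dicut X \<Longrightarrow> \<exists>a\<in>J. C.leaves a X" using C.small_dijoin by blast
  have "set p \<inter> J \<noteq> {}" if p: "cycle p" for p
  proof -
    obtain h :: "complex set \<Rightarrow> int" where h: "\<And>a. a \<in> arcs G \<Longrightarrow> of_bool (a \<in> set p) = h (l a) - h (r a)"
      using F(4)[OF cycle_circulation[OF p]] by blast
    have "p \<noteq> []" "set p \<subseteq> arcs G" using p by (auto simp: cycle_def awalk_def)
    then obtain a where a: "a \<in> set p" "a \<in> arcs G" by (meson hd_in_set subsetD)
    \<comment> \<open>The potential \<open>h\<close> drops by 1 along the arcs of the cycle and is
      unchanged along all others. So no arc enters an upper level set, and only arcs of the cycle
      leave it; the level \<open>h (l a)\<close> makes it proper and nonempty.\<close>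
    define X where "X = {x\<in>F. h (l a) \<le> h x}"
    have "r a \<notin> X" "l a \<in> X" using h[OF a(2)] a F(2) by (auto simp: X_def)
    moreover have "l b \<in> X" if "b \<in> arcs G" "r b \<in> X" for b
    proof -
      have "h (r b) \<le> h (l b)" using h[OF that(1)] by (auto simp: of_bool_def split: if_splits)
      then show ?thesis using that F(2) by (auto simp: X_def)
    qed
    ultimately have "C.dicut X" using F(2)[OF a(2)] unfolding C.dicut_def by (auto simp: X_def)
    then obtain b where b: "b \<in> J" "C.leaves b X" using J(3) by blast
    then have "b \<in> arcs G" using J(1) by blast
    then have "h (l b) \<noteq> h (r b)" using b(2) F(2) by (auto simp: C.leaves_def X_def)
    then have "b \<in> set p" using h[OF \<open>b \<in> arcs G\<close>] by (auto simp: of_bool_def split: if_splits)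
    then show ?thesis using b(1) by blast
  qed
  then show ?thesis using J by blast
qed

text \<open>This serves both choices of \<open>S\<close>: the complement of the tails of
  \<open>J\<close>, and a set independent with respect to \<open>J\<close>.\<close>

lemma acyclic_set_if_avoids:
  assumes S: "S \<subseteq> verts G" and J: "\<And>p. cycle p \<Longrightarrow> set p \<inter> J \<noteq> {}"
    and indep: "\<And>a. a \<in> J \<Longrightarrow> \<not> (tail G a \<in> S \<and> head G a \<in> S)"
  shows "acyclic_set G S"
  unfolding acyclic_set_def
proof (intro conjI notI S)
  assume "\<exists>p. pre_digraph.cycle (G \<restriction> S) p"
  then obtain p where p: "pre_digraph.cycle (G \<restriction> S) p" by blast
  have "subgraph (G \<restriction> S) G" using induced_induce[OF S] by (simp add: induced_subgraph_def)
  then have "cycle p" using subgraph_cycle p by blast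
  then obtain a where a: "a \<in> set p" "a \<in> J" using J by blast
  have "set p \<subseteq> arcs (G \<restriction> S)" using p by (auto simp: pre_digraph.cycle_def pre_digraph.awalk_def)
  then show False using a indep by auto
qed

end

theorem theorem2p5:
  fixes D :: "('a, 'b) pre_digraph" and n :: nat and g :: enat
  assumes "oriented_graph D"
    and "planar_digraph D"
    and "card (verts D) = n"
    and "digirth D = g"
  shows "(\<exists>S. acyclic_set D S \<and>
            ereal (real n) - 3 * ereal (real n) / ereal_of_enat g \<le> ereal (real (card S))) \<and>
         (g = 4 \<longrightarrow> (\<exists>S. acyclic_set D S \<and> 5 * real n / 12 \<le> real (card S))) \<and>
         (g = 5 \<longrightarrow> (\<exists>S. acyclic_set D S \<and> 7 * real n / 15 \<le> real (card S)))"
proof (cases g)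
  case infinity
  interpret oriented_graph D by fact
  have "\<not> cycle p" for p
  proof
    assume "cycle p"
    then have "digirth D \<le> enat (length p)" unfolding digirth_def by (intro INF_lower) simp
    then show False using assms(4) infinity by simp
  qed
  \<comment> \<open>Here \<open>3 n / g\<close> is 0, so the whole vertex set is required, and with
    no directed cycle it is acyclic.\<close>
  then have "acyclic_set D (verts D)" by (intro acyclic_set_if_avoids[where J = "{}"]) auto
  then show ?thesis using infinity assms(3) by auto
next
  case (enat k)
  interpret oriented_graph D by fact
  have len: "k \<le> length p" if "cycle p" for p
  proof -
    have "digirth D \<le> enat (length p)" unfolding digirth_def using that by (intro INF_lower) simp
    then show ?thesis using assms(4) enat by simp
  qed
  have "enat 1 \<le> digirth D" unfolding digirth_def
    by (intro INF_greatest) (auto simp: cycle_def Suc_le_eq)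
  then have k: "k \<ge> 1" using assms(4) enat by simp
  obtain J where J: "J \<subseteq> arcs D" "card J * k \<le> card (arcs D)" "\<And>p. cycle p \<Longrightarrow> set p \<inter> J \<noteq> {}"
    using small_feedback_arc_set[OF assms(2) len] by blast
  have Jn: "card J * k \<le> 3 * n" using J(2) planar_arcs_le[OF assms(2)] assms(3) by linarith
  have finJ: "finite J" using J(1) finite_arcs finite_subset by blast
  have first: "\<exists>S. acyclic_set D S \<and> ereal (real n) - 3 * ereal (real n) / ereal_of_enat g \<le> ereal (real (card S))"
  proof (intro exI conjI)
    show "acyclic_set D (verts D - tail D ` J)"
      by (rule acyclic_set_if_avoids[OF _ J(3)]) auto
    have "card (tail D ` J) \<le> card J" by (rule card_image_le[OF finJ])
    moreover have "card (verts D) - card (tail D ` J) \<le> card (verts D - tail D ` J)"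
      by (rule diff_card_le_card_Diff) (simp add: finJ)
    ultimately have "real n - real (card J) \<le> real (card (verts D - tail D ` J))" using assms(3) by linarith
    moreover have "real (card J) \<le> 3 * real n / real k"
    proof -
      have "real (card J) * real k \<le> 3 * real n" using Jn by (metis of_nat_le_iff of_nat_mult of_nat_numeral)
      then show ?thesis using k by (simp add: pos_le_divide_eq)
    qed
    ultimately have "real n - 3 * real n / real k \<le> real (card (verts D - tail D ` J))" by linarith
    then show "ereal (real n) - 3 * ereal (real n) / ereal_of_enat g \<le> ereal (real (card (verts D - tail D ` J)))"
      using enat k by simp
  qed
  have "\<exists>S\<subseteq>verts D. (\<forall>a\<in>J. \<not> (tail D a \<in> S \<and> head D a \<in> S)) \<and>
      2 * card (verts D) \<le> card J + 3 * card S"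
    by (rule large_independent_set) (use finJ J(1) no_loops in auto)
  then obtain S where S: "S \<subseteq> verts D" "\<forall>a\<in>J. \<not> (tail D a \<in> S \<and> head D a \<in> S)"
    "2 * card (verts D) \<le> card J + 3 * card S" by blast
  have acy: "acyclic_set D S" using acyclic_set_if_avoids[OF S(1) J(3)] S(2) by blast
  have Sn: "2 * n \<le> card J + 3 * card S" using S(3) assms(3) by simp
  have "5 * real n / 12 \<le> real (card S)" if "g = 4"
  proof -
    have "k = 4" using that enat by (simp add: numeral_eq_enat)
    \<comment> \<open>Four times \<open>Sn\<close> with \<open>4 * card J \<le> 3 * n\<close>
      inserted: \<open>8 n \<le> 3 n + 12 * card S\<close>. The case \<open>g = 5\<close> is
      \<open>10 n \<le> 3 n + 15 * card S\<close>.\<close>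
    then have "5 * n \<le> 12 * card S" using Jn Sn by simp
    then show ?thesis by linarith
  qed
  moreover have "7 * real n / 15 \<le> real (card S)" if "g = 5"
  proof -
    have "k = 5" using that enat by (simp add: numeral_eq_enat)
    then have "7 * n \<le> 15 * card S" using Jn Sn by simp
    then show ?thesis by linarith
  qed
  ultimately show ?thesis using first acy by blast
qed

end
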